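(* Suppose that $X$ is a dense-in-itself metric space. Then every finite connected locally connected $\mathrm{KD4}$ frame $\mathcal F=(W,R)$ is fully representable over $X$.
   Context: A metric space is regarded as a topological space with its metric topology; it is dense in itself if no singleton subset is open. Spaces may be empty. $\mathrm{cl}$ and $\mathrm{int}$ are closure and interior in $X$. For $S\subseteq X$, $\langle d\rangle S=\{x\in X: S\cap O\setminus\{x\}\neq\emptyset\text{ for every open neighbourhood }O\text{ of }x\}$. A frame is a pair $\mathcal F=(W,R)$ with $W\neq\emptyset$ and $R\subseteq W\times W$; it is a $\mathrm{KD4}$ frame if $R$ is transitive and serial (for all $w$ there is $v$ with $Rwv$). $R(w)=\{v:Rwv\}$. A frame is connected if any two of its points are linked by a finite path $w_0,\dots,w_n$ ($n\ge0$) with $Rw_iw_{i+1}$ or $Rw_{i+1}w_i$ for each $i<n$ (equivalently, it is not the union of two disjoint non-empty $R$-closed subsets), and locally connected if for each $w\in W$ the frame $(R(w),R\cap(R(w)\times R(w)))$ is connected. Let $U\subseteq X$ be open (with the subspace topology). A map $\rho:U\to W$ is a representation of $\mathcal F$ over $U$ if for all $x\in U$ and $w\in W$: $x\in\langle d\rangle\rho^{-1}(w)$ iff $R(\rho(x),w)$, where $\rho^{-1}(w)=\{y\in U:\rho(y)=w\}$. (The empty map is a representation over the empty space.) For open $S\subseteq U\subseteq X$, a representation $\sigma:S\to W$ of $\mathcal F$ over $S$ is $U$-basic if for all $x\in U$ and $w,v\in W$: if $x\in\mathrm{cl}\,\sigma^{-1}(w)\cap\mathrm{cl}\,\sigma^{-1}(v)$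 then $Rwv$. For open $T\subseteq U\subseteq X$, a representation $\rho:U\to W$ of $\mathcal F$ over $U$ is $T$-full if (1) for every $x\in\mathrm{cl}(T)\setminus U$ and $w\in W$, $x\in\langle d\rangle\rho^{-1}(w)$ (derivative taken in $X$), and (2) if $T\neq\emptyset$ then $\rho:U\to W$ is surjective. A subset $S$ of an open set $U$ is a regular open subset of $U$ if $S=\mathrm{int}(U\cap\mathrm{cl}\,S)$. $\mathcal F$ is fully representable over $X$ if whenever $U\subseteq X$ is open, $S$ is a regular open subset of $U$, $\sigma:S\to W$ is a $U$-basic representation of $\mathcal F$ over $S$, and $T=U\setminus\mathrm{cl}\,S$, then $\sigma$ extends to a $T$-full representation $\rho:U\to W$ of $\mathcal F$ over $U$. *)

theory Defs
  imports "HOL-Analysis.Analysis"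
begin

text \<open>
  Topological notions are relative to an abstract topology, so that the space may be empty.
  The operator \<open>\<langle>d\<rangle>\<close> is the library's \<^const>\<open>derived_set_of\<close>.
\<close>

definition dense_in_itself :: "'a topology \<Rightarrow> bool"
  where "dense_in_itself X \<longleftrightarrow> (\<forall>x\<in>topspace X. \<not> openin X {x})"

definition regular_open_subset :: "'a topology \<Rightarrow> 'a set \<Rightarrow> 'a set \<Rightarrow> bool"
  where "regular_open_subset X U S \<longleftrightarrow>
    openin X U \<and> S \<subseteq> U \<and> S = X interior_of (U \<inter> X closure_of S)"

definition frame :: "'w set \<Rightarrow> ('w \<times> 'w) set \<Rightarrow> bool"
  where "frame W R \<longleftrightarrow> W \<noteq> {} \<and> R \<subseteq> W \<times> W"

definition KD4_frame :: "'w set \<Rightarrow> ('w \<times> 'w) set \<Rightarrow> bool"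
  where "KD4_frame W R \<longleftrightarrow> frame W R \<and> trans R \<and> (\<forall>w\<in>W. \<exists>v\<in>W. (w, v) \<in> R)"

definition connected_frame :: "'w set \<Rightarrow> ('w \<times> 'w) set \<Rightarrow> bool"
  where "connected_frame W R \<longleftrightarrow> (\<forall>u\<in>W. \<forall>v\<in>W. (u, v) \<in> (R \<union> R\<inverse>)\<^sup>*)"

definition locally_connected_frame :: "'w set \<Rightarrow> ('w \<times> 'w) set \<Rightarrow> bool"
  where "locally_connected_frame W R \<longleftrightarrow>
    (\<forall>w\<in>W. connected_frame (R `` {w}) (R \<inter> (R `` {w} \<times> R `` {w})))"

text \<open>
  A map \<open>U \<rightarrow> W\<close> is a total function whose values outside \<open>U\<close> are irrelevant: every
  definition below uses only its values on \<open>U\<close>.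
\<close>

definition fibre :: "'a set \<Rightarrow> ('a \<Rightarrow> 'w) \<Rightarrow> 'w \<Rightarrow> 'a set"
  where "fibre U \<rho> w = {y \<in> U. \<rho> y = w}"

definition representation ::
    "'a topology \<Rightarrow> 'a set \<Rightarrow> 'w set \<Rightarrow> ('w \<times> 'w) set \<Rightarrow> ('a \<Rightarrow> 'w) \<Rightarrow> bool"
  where "representation X U W R \<rho> \<longleftrightarrow>
    openin X U \<and> \<rho> \<in> U \<rightarrow> W \<and>
    (\<forall>x\<in>U. \<forall>w\<in>W. x \<in> X derived_set_of (fibre U \<rho> w) \<longleftrightarrow> (\<rho> x, w) \<in> R)"

definition basic_representation ::
    "'a topology \<Rightarrow> 'a set \<Rightarrow> 'a set \<Rightarrow> 'w set \<Rightarrow> ('w \<times> 'w) set \<Rightarrow> ('a \<Rightarrow> 'w) \<Rightarrow> bool"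
  where "basic_representation X U S W R \<sigma> \<longleftrightarrow>
    openin X U \<and> S \<subseteq> U \<and> representation X S W R \<sigma> \<and>
    (\<forall>x\<in>U. \<forall>w\<in>W. \<forall>v\<in>W.
      x \<in> X closure_of (fibre S \<sigma> w) \<inter> X closure_of (fibre S \<sigma> v) \<longrightarrow> (w, v) \<in> R)"

definition full_representation ::
    "'a topology \<Rightarrow> 'a set \<Rightarrow> 'a set \<Rightarrow> 'w set \<Rightarrow> ('w \<times> 'w) set \<Rightarrow> ('a \<Rightarrow> 'w) \<Rightarrow> bool"
  where "full_representation X T U W R \<rho> \<longleftrightarrow>
    openin X T \<and> T \<subseteq> U \<and> representation X U W R \<rho> \<and>
    (\<forall>x \<in> X closure_of T - U. \<forall>w\<in>W. x \<in> X derived_set_of (fibre U \<rho> w)) \<and>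
    (T \<noteq> {} \<longrightarrow> \<rho> ` U = W)"

definition fully_representable :: "'a topology \<Rightarrow> 'w set \<Rightarrow> ('w \<times> 'w) set \<Rightarrow> bool"
  where "fully_representable X W R \<longleftrightarrow>
    (\<forall>U S \<sigma>. openin X U \<longrightarrow> regular_open_subset X U S \<longrightarrow> basic_representation X U S W R \<sigma> \<longrightarrow>
      (\<exists>\<rho>. full_representation X (U - X closure_of S) U W R \<rho> \<and> (\<forall>x\<in>S. \<rho> x = \<sigma> x)))"

end

theory Submission
  imports Defs
begin

text \<open>
  The proof is an induction on the number of worlds of an upward closed connected subframe \<open>V\<close>,
  with the relation \<open>R\<close> of the whole frame kept fixed. Let \<open>\<sigma>\<close> be a basic representation over \<open>S\<close>, put
  \<open>T = U - cl S\<close>, and call the points of \<open>cl T - U\<close> the outer boundary and those of \<open>U \<inter> cl S - S\<close> the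
  inner boundary. Because \<open>S\<close> is regular open, the inner boundary, too, lies in \<open>cl T\<close>. There are three
  cases.

  If \<open>V\<close> has a reflexive root, \<open>T\<close> is dissected in the style of Tarski (\<open>dissection\<close>) into one set for
  each world: open sets for the worlds outside the root cluster, arbitrary ones for the worlds
  inside it, arranged so that every point of \<open>cl T\<close> outside the open sets is a limit of all the sets.
  On the open set of a world \<open>v\<close> the induction hypothesis represents the cone of \<open>v\<close>, and fullness
  makes the boundary points of that open set limits of the fibre of \<open>v\<close>. Every remaining point,
  including those of the inner boundary, is then a limit of every fibre, and so it may be sent to a
  world of the root cluster (\<open>fully_representable_reflexive_root\<close>).

  If \<open>V\<close> has an irreflexive root \<open>r\<close>, the root is placed on a set \<open>Z\<close> which is closed and discrete in
  \<open>U\<close> and accumulates at the whole outer boundary. The rest of \<open>V\<close> is connected by local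
  connectedness; the induction hypothesis for it over \<open>U - Z\<close> is full, which makes the points of \<open>Z\<close>,
  now on the outer boundary, limits of every world that \<open>r\<close> sees
  (\<open>fully_representable_irreflexive_root\<close>).

  If \<open>V\<close> has no root, it is the union of two smaller connected upward closed sets \<open>A\<close> and \<open>B\<close> with a
  common point (\<open>rootless_connected_decomposition\<close>), and \<open>A \<inter> B\<close> contains a final cluster \<open>K\<close>. Basicness
  keeps the parts of \<open>S\<close> labelled in \<open>A\<close> and in \<open>V - A\<close> apart in \<open>U\<close>. Normality provides an open
  interface between them; it is labelled by \<open>K\<close>, and \<open>A\<close> and \<open>B\<close> are represented on the two sides of
  \<open>U\<close>, which overlap exactly in the interface (\<open>fully_representable_union\<close>). The definition of full
  representability by extension of a given \<open>\<sigma>\<close> is what makes this step possible.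
\<close>

section \<open>Limit points and discrete sets\<close>

lemma (in Metric_space) separated_derived_set_empty:
  assumes "0 < e" and "\<And>x y. \<lbrakk>x \<in> Z; y \<in> Z; x \<noteq> y\<rbrakk> \<Longrightarrow> e \<le> d x y"
  shows "mtopology derived_set_of Z = {}"
proof (rule ccontr)
  assume "mtopology derived_set_of Z \<noteq> {}"
  then obtain x where x: "x \<in> M" and lim: "\<And>r. r > 0 \<Longrightarrow> \<exists>y\<in>Z. y \<noteq> x \<and> y \<in> mball x r"
    unfolding metric_derived_set_of by blast
  obtain y where y: "y \<in> Z" "y \<noteq> x" "y \<in> mball x (e/2)"
    using lim[of "e/2"] \<open>0 < e\<close> by auto
  obtain z where z: "z \<in> Z" "z \<noteq> x" "z \<in> mball x (min (e/2) (d x y))"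
    using lim[of "min (e/2) (d x y)"] y \<open>0 < e\<close> x by auto
  have "y \<noteq> z" using z by auto
  then have "e \<le> d y z" using assms(2) y z by blast
  moreover have "d y z \<le> d x y + d x z"
    using y z x by (metis commute in_mball triangle)
  ultimately show False using y z by auto
qed

text \<open>
  Among the subsets of \<open>A\<close> with mutual distances at least \<open>e\<close>, a maximal one is an \<open>e\<close>-net of \<open>A\<close>.
\<close>

lemma (in Metric_space) maximal_separated_subset:
  assumes "A \<subseteq> M" and "0 < e"
  obtains Z where "Z \<subseteq> A" "mtopology derived_set_of Z = {}" "\<And>a. a \<in> A \<Longrightarrow> \<exists>z\<in>Z. d a z < e"
proof -
  define \<Z> where "\<Z> = {Z. Z \<subseteq> A \<and> (\<forall>x\<in>Z. \<forall>y\<in>Z. x \<noteq> y \<longrightarrow> e \<le> d x y)}"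
  have "\<exists>Z\<in>\<Z>. \<forall>Y\<in>\<Z>. Z \<subseteq> Y \<longrightarrow> Y = Z"
  proof (rule subset_Zorn')
    fix C assume C: "subset.chain \<Z> C"
    have "e \<le> d x y" if "x \<in> P" "y \<in> Q" "P \<in> C" "Q \<in> C" "x \<noteq> y" for x y P Q
    proof -
      have "P \<subseteq> Q \<or> Q \<subseteq> P" "P \<in> \<Z>" "Q \<in> \<Z>"
        using C that unfolding subset_chain_def by auto
      then show ?thesis using that unfolding \<Z>_def by blast
    qed
    moreover have "\<Union>C \<subseteq> A" using C unfolding subset_chain_def \<Z>_def by blast
    ultimately show "\<Union>C \<in> \<Z>" unfolding \<Z>_def by blast
  qed
  then obtain Z where Z: "Z \<in> \<Z>" and max: "\<And>Y. Y \<in> \<Z> \<Longrightarrow> Z \<subseteq> Y \<Longrightarrow> Y = Z" by blast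
  show ?thesis
  proof
    show "Z \<subseteq> A" using Z by (simp add: \<Z>_def)
    show "mtopology derived_set_of Z = {}"
      using separated_derived_set_empty[of e Z] Z \<open>0 < e\<close> by (auto simp: \<Z>_def)
    fix a assume a: "a \<in> A"
    show "\<exists>z\<in>Z. d a z < e"
    proof (rule ccontr)
      assume no: "\<not> (\<exists>z\<in>Z. d a z < e)"
      then have "insert a Z \<in> \<Z>"
        using Z a unfolding \<Z>_def by (auto simp: commute not_less)
      then have "a \<in> Z" using max by blast
      then show False using no a \<open>A \<subseteq> M\<close> \<open>0 < e\<close> by (metis mdist_zero subsetD)
    qed
  qed
qed

lemma dense_in_itself_openin_limit:
  assumes "dense_in_itself X" "openin X U"
  shows "U \<subseteq> X derived_set_of U"
proof
  fix x assume x: "x \<in> U"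
  have xX: "x \<in> topspace X" using x assms(2) openin_subset by blast
  show "x \<in> X derived_set_of U"
    unfolding in_derived_set_of
  proof (intro conjI allI impI)
    show "x \<in> topspace X" by fact
    fix T assume T: "x \<in> T \<and> openin X T"
    then have "openin X (U \<inter> T)" using assms(2) by blast
    moreover have "\<not> openin X {x}" using assms(1) xX by (simp add: dense_in_itself_def)
    ultimately have "U \<inter> T \<noteq> {x}" by metis
    then show "\<exists>y. y \<noteq> x \<and> y \<in> U \<and> y \<in> T" using x T by blast
  qed
qed

lemma dense_in_itself_interior_of_discrete:
  assumes "dense_in_itself X" "X derived_set_of Z \<inter> Z = {}"
  shows "X interior_of Z = {}"
proof -
  have "X interior_of Z \<subseteq> X derived_set_of (X interior_of Z)"
    by (rule dense_in_itself_openin_limit[OF assms(1) openin_interior_of])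
  also have "\<dots> \<subseteq> X derived_set_of Z" by (simp add: derived_set_of_mono interior_of_subset)
  finally show ?thesis using assms(2) interior_of_subset[of X Z] by blast
qed

lemma closure_of_minus_empty_interior:
  assumes "openin X U" "X interior_of Z = {}"
  shows "X closure_of (U - Z) = X closure_of U"
proof
  show "X closure_of (U - Z) \<subseteq> X closure_of U" by (rule closure_of_mono) blast
  show "X closure_of U \<subseteq> X closure_of (U - Z)"
  proof
    fix x assume x: "x \<in> X closure_of U"
    have "\<exists>y. y \<in> U - Z \<and> y \<in> T" if "x \<in> T" "openin X T" for T
    proof (rule ccontr)
      assume "\<nexists>y. y \<in> U - Z \<and> y \<in> T"
      then have "U \<inter> T \<subseteq> Z" by blast
      then have "U \<inter> T \<subseteq> X interior_of Z"
        using that assms(1) by (simp add: interior_of_maximal openin_Int)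
      then show False using assms(2) x that unfolding in_closure_of by blast
    qed
    then show "x \<in> X closure_of (U - Z)" using x unfolding in_closure_of by blast
  qed
qed

text \<open>
  The set \<open>Z\<close> is a union of nets, one for each scale \<open>1 / (n + 1)\<close>, of the points of \<open>T\<close> that come
  within that distance of the boundary \<open>cl T - U\<close>. Finer and finer nets accumulate at the whole
  boundary, whereas a point of \<open>U\<close> has a positive distance from it and is close to only finitely
  many of them.
\<close>

lemma (in Metric_space) discrete_set_reaching_boundary:
  assumes TU: "T \<subseteq> U" and U: "openin mtopology U"
  obtains Z where "Z \<subseteq> T" "mtopology derived_set_of Z \<inter> U = {}"
    "mtopology closure_of T - U \<subseteq> mtopology derived_set_of Z" "T \<noteq> {} \<Longrightarrow> Z \<noteq> {}"
proof -
  define E where "E = mtopology closure_of T - U"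
  have UM: "U \<subseteq> M" using U openin_subset by force
  define A where "A n = {t \<in> T. \<exists>e\<in>E. d t e < inverse (Suc n)}" for n
  have "\<forall>n. \<exists>Z \<subseteq> A n. mtopology derived_set_of Z = {} \<and> (\<forall>a\<in>A n. \<exists>z\<in>Z. d a z < inverse (Suc n))"
  proof
    fix n
    have "A n \<subseteq> M" using TU UM by (auto simp: A_def)
    then obtain Z where "Z \<subseteq> A n" "mtopology derived_set_of Z = {}"
        "\<And>a. a \<in> A n \<Longrightarrow> \<exists>z\<in>Z. d a z < inverse (Suc n)"
      by (rule maximal_separated_subset[of "A n" "inverse (Suc n)"]) auto
    then show "\<exists>Z \<subseteq> A n. mtopology derived_set_of Z = {} \<and> (\<forall>a\<in>A n. \<exists>z\<in>Z. d a z < inverse (Suc n))"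
      by blast
  qed
  then obtain Z where ZA: "\<And>n. Z n \<subseteq> A n" and Zd: "\<And>n. mtopology derived_set_of (Z n) = {}"
      and Zn: "\<And>n a. a \<in> A n \<Longrightarrow> \<exists>z\<in>Z n. d a z < inverse (Suc n)"
    by metis
  \<comment> \<open>If the boundary is empty, so are all the nets; \<open>P\<close> keeps \<open>Z\<close> non-empty even then.\<close>
  obtain P where P: "P \<subseteq> T" "finite P" "T \<noteq> {} \<Longrightarrow> P \<noteq> {}"
  proof (cases "T = {}")
    case False
    then obtain t where "t \<in> T" by blast
    then show ?thesis by (intro that[of "{t}"]) auto
  qed (auto intro: that[of "{}"])
  have Pd: "mtopology derived_set_of P = {}"
    using P(2) Hausdorff_space_mtopology by (simp add: derived_set_of_finite)
  have limU: "x \<notin> mtopology derived_set_of (\<Union>n. Z n)" if x: "x \<in> U" for x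
  proof
    assume xd: "x \<in> mtopology derived_set_of (\<Union>n. Z n)"
    obtain r where r: "r > 0" "mball x r \<subseteq> U" using U x openin_mtopology by blast
    obtain N where N: "inverse (real (Suc N)) < r / 2" using reals_Archimedean r by (metis half_gt_zero)
    \<comment> \<open>Points of \<open>E\<close> have distance at least \<open>r\<close> from \<open>x\<close>, so only the first \<open>N + 1\<close> nets come within \<open>r / 2\<close> of \<open>x\<close>.\<close>
    have far: "mball x (r/2) \<inter> Z n = {}" if "n > N" for n
    proof (rule ccontr)
      assume "mball x (r/2) \<inter> Z n \<noteq> {}"
      then obtain z e where z: "z \<in> mball x (r/2)" "e \<in> E" "d z e < inverse (real (Suc n))"
        using ZA unfolding A_def by blast
      have "inverse (real (Suc n)) \<le> inverse (real (Suc N))" using that by (simp add: field_simps)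
      then have "d z e < r/2" using N z by linarith
      moreover have eM: "e \<in> M" using z(2) by (auto simp: E_def metric_closure_of)
      ultimately have "d x e < r" using z(1) triangle[of x z e] by auto
      then have "e \<in> U" using r z eM by auto
      then show False using z by (simp add: E_def)
    qed
    have "x \<in> mball x (r/2) \<inter> mtopology derived_set_of (\<Union>n. Z n)"
      using xd r x UM by auto
    then have "x \<in> mtopology derived_set_of (mball x (r/2) \<inter> (\<Union>n. Z n))"
      by (meson openin_Int_derived_set_of_subset openin_mball subsetD)
    also have "\<dots> \<subseteq> mtopology derived_set_of (\<Union>n\<in>{..N}. Z n)"
      using far by (intro derived_set_of_mono) (force simp: not_le[symmetric])
    also have "\<dots> = {}" using Zd by (simp add: derived_set_of_Union)
    finally show False by simp
  qed
  have limE: "x \<in> mtopology derived_set_of (\<Union>n. Z n)" if x: "x \<in> E" for x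
  proof -
    have xM: "x \<in> M" using x by (auto simp: E_def metric_closure_of)
    have "\<exists>y\<in>\<Union>n. Z n. y \<noteq> x \<and> y \<in> mball x r" if r: "r > 0" for r
    proof -
      obtain N where N: "inverse (real (Suc N)) < r / 2" using reals_Archimedean r by (metis half_gt_zero)
      have "inverse (real (Suc N)) > 0" by simp
      then obtain t where t: "t \<in> T" "t \<in> mball x (inverse (Suc N))"
        using x unfolding E_def metric_closure_of by blast
      then have "t \<in> A N" using x by (auto simp: A_def commute)
      then obtain z where z: "z \<in> Z N" "d t z < inverse (Suc N)" using Zn by blast
      have zT: "z \<in> T" using z ZA by (auto simp: A_def)
      then have zM: "z \<in> M" using TU UM by blast
      have "d x z \<le> d x t + d t z" using triangle[OF xM _ zM] t by auto
      then have "d x z < r" using t z N by auto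
      moreover have "z \<noteq> x" using zT TU x by (auto simp: E_def)
      ultimately show ?thesis using z xM zM by auto
    qed
    then show ?thesis using xM unfolding metric_derived_set_of by blast
  qed
  show ?thesis
  proof
    show "P \<union> (\<Union>n. Z n) \<subseteq> T" using P ZA by (auto simp: A_def)
    show "mtopology derived_set_of (P \<union> (\<Union>n. Z n)) \<inter> U = {}"
      using limU by (auto simp: derived_set_of_Un Pd)
    show "mtopology closure_of T - U \<subseteq> mtopology derived_set_of (P \<union> (\<Union>n. Z n))"
      using limE by (auto simp: derived_set_of_Un E_def)
    show "P \<union> (\<Union>n. Z n) \<noteq> {}" if "T \<noteq> {}" using P(3)[OF that] by blast
  qed
qed

text \<open>
  Removing a discrete set \<open>Y\<close> from \<open>T\<close> does not change its closure, so \<open>T - Y\<close> provides the second set.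
\<close>

lemma (in Metric_space) two_discrete_sets_reaching_boundary:
  assumes dii: "dense_in_itself mtopology"
    and TU: "T \<subseteq> U" and T: "openin mtopology T" and U: "openin mtopology U"
  obtains Y Z where "Y \<subseteq> T" "Z \<subseteq> T" "Y \<inter> Z = {}"
    "mtopology derived_set_of Y \<inter> U = {}" "mtopology derived_set_of Z \<inter> U = {}"
    "mtopology closure_of T - U \<subseteq> mtopology derived_set_of Y"
    "mtopology closure_of T - U \<subseteq> mtopology derived_set_of Z"
    "T \<noteq> {} \<Longrightarrow> Y \<noteq> {}" "T \<noteq> {} \<Longrightarrow> Z \<noteq> {}"
proof -
  obtain Y where Y: "Y \<subseteq> T" "mtopology derived_set_of Y \<inter> U = {}"
    "mtopology closure_of T - U \<subseteq> mtopology derived_set_of Y" "T \<noteq> {} \<Longrightarrow> Y \<noteq> {}"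
    using discrete_set_reaching_boundary[OF TU U] by metis
  have "mtopology interior_of Y = {}"
    using Y TU by (intro dense_in_itself_interior_of_discrete[OF dii]) blast
  then have cl: "mtopology closure_of (T - Y) = mtopology closure_of T"
    by (rule closure_of_minus_empty_interior[OF T])
  have "T - Y \<subseteq> U" using TU by blast
  then obtain Z where Z: "Z \<subseteq> T - Y" "mtopology derived_set_of Z \<inter> U = {}"
    "mtopology closure_of (T - Y) - U \<subseteq> mtopology derived_set_of Z" "T - Y \<noteq> {} \<Longrightarrow> Z \<noteq> {}"
    using discrete_set_reaching_boundary[OF _ U] by metis
  have "T - Y \<noteq> {}" if "T \<noteq> {}"
    using cl that T by (metis closure_of_empty closure_of_subset openin_subset subset_empty)
  then show ?thesis using that[of Y Z] Y Z cl by blast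
qed

section \<open>Dissection of an open set\<close>

text \<open>
  If \<open>C\<close> contained a neighbourhood of \<open>x\<close> relative to \<open>V\<close>, then \<open>x\<close> would belong to \<open>C\<close>, because \<open>C\<close> is closed,
  hence to \<open>V\<close>, and so to the interior of \<open>C\<close>.
\<close>

lemma closure_of_minus_closed_subset:
  assumes V: "openin X V" and C: "closedin X C" "C \<subseteq> V"
    and x: "x \<in> X closure_of V" "x \<notin> X interior_of C"
  shows "x \<in> X closure_of (V - C)"
  unfolding in_closure_of
proof (intro conjI allI impI)
  show "x \<in> topspace X" using x by (simp add: in_closure_of)
  fix N assume N: "x \<in> N \<and> openin X N"
  show "\<exists>y. y \<in> V - C \<and> y \<in> N"
  proof (rule ccontr)
    assume "\<nexists>y. y \<in> V - C \<and> y \<in> N"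
    then have NV: "N \<inter> V \<subseteq> C" by blast
    then have int: "N \<inter> V \<subseteq> X interior_of C"
      using V N by (simp add: interior_of_maximal openin_Int)
    have "x \<in> N \<inter> X closure_of V" using N x by blast
    then have "x \<in> X closure_of (N \<inter> V)" using N openin_Int_closure_of_subset[of X N V] by blast
    then have "x \<in> X closure_of C" using closure_of_mono[OF NV, of X] by blast
    moreover have "X closure_of C = C" using C(1) by (simp add: closure_of_eq)
    ultimately have "x \<in> N \<inter> V" using C(2) N by blast
    then show False using int x by blast
  qed
qed

lemma recurring_enumeration:
  assumes "countable K" "j \<in> K"
  obtains e :: "nat \<Rightarrow> 'k" where "range e \<subseteq> K" "e 0 = j" "\<And>k N. k \<in> K \<Longrightarrow> \<exists>n\<ge>N. e n = k"
proof -
  define e where "e n = (if n = 0 then j else from_nat_into K (fst (prod_decode n)))" for n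
  show ?thesis
  proof
    show "range e \<subseteq> K" using assms from_nat_into[of K] by (auto simp: e_def)
    show "e 0 = j" by (simp add: e_def)
    fix k N assume k: "k \<in> K"
    then obtain a where a: "from_nat_into K a = k" using assms(1) from_nat_into_surj by metis
    define n where "n = prod_encode (a, Suc N)"
    have "Suc N \<le> n" unfolding n_def by (rule le_prod_encode_2)
    moreover have "e n = k" using \<open>Suc N \<le> n\<close> a by (simp add: e_def n_def)
    ultimately show "\<exists>n\<ge>N. e n = k" by (intro exI[of _ n]) auto
  qed
qed

text \<open>
  Closed sets \<open>C n\<close> are removed from \<open>T\<close> one after the other, each one contained in what is left, which
  is the open set \<open>U n\<close>, and each one assigned to a label in such a way that every label recurs. For a
  label in \<open>J\<close>, \<open>C n\<close> is a net of \<open>U n\<close> of mesh \<open>1 / (n + 1)\<close>; for a label in \<open>I\<close> it is a closed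
  neighbourhood of such a net inside \<open>U n\<close>, and only its interior receives the label. A point that is
  in none of these interiors stays in the closure of every \<open>U n\<close> (\<open>closure_of_minus_closed_subset\<close>),
  so it is close to the nets of all later stages and thus a limit of every label. The points
  that never receive a label are given an arbitrary one in \<open>J\<close>.
\<close>

lemma (in Metric_space) dissection:
  fixes I J :: "'k set"
  assumes dii: "dense_in_itself mtopology" and T: "openin mtopology T"
    and IJ: "countable I" "countable J" "I \<inter> J = {}" "J \<noteq> {}"
  obtains \<kappa> where "\<kappa> \<in> T \<rightarrow> I \<union> J" "\<And>i. i \<in> I \<Longrightarrow> openin mtopology (fibre T \<kappa> i)"
    "\<And>x k. \<lbrakk>x \<in> mtopology closure_of T; x \<in> T \<Longrightarrow> \<kappa> x \<in> J; k \<in> I \<union> J\<rbrakk>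
       \<Longrightarrow> x \<in> mtopology derived_set_of (fibre T \<kappa> k)"
    "T \<noteq> {} \<Longrightarrow> \<exists>x\<in>T. \<kappa> x \<in> J"
proof -
  obtain j where j: "j \<in> J" using IJ by blast
  have "countable (I \<union> J)" using IJ by simp
  then obtain e :: "nat \<Rightarrow> 'k" where e: "range e \<subseteq> I \<union> J" "e 0 = j"
      and rec: "\<And>k N. k \<in> I \<union> J \<Longrightarrow> \<exists>n\<ge>N. e n = k"
    using recurring_enumeration[of "I \<union> J" j] j by blast
  \<comment> \<open>The part of the \<open>n\<close>-th closed set that receives the label \<open>e n\<close>.\<close>
  define core where "core n C = (if e n \<in> J then C else mtopology interior_of C)" for n C
  have core_sub: "core n C \<subseteq> C" for n C by (simp add: core_def interior_of_subset)
  define good where "good n V C \<longleftrightarrow> closedin mtopology C \<and> C \<subseteq> V \<and>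
      (e n \<in> J \<longrightarrow> mtopology derived_set_of C = {}) \<and>
      (\<forall>x\<in>V. \<exists>y\<in>core n C. d x y < inverse (Suc n))" for n V C
  have good_ex: "\<exists>C. good n V C" if V: "openin mtopology V" for n V
  proof -
    have VM: "V \<subseteq> M" using V openin_subset by force
    obtain Y where Y: "Y \<subseteq> V" "mtopology derived_set_of Y = {}"
        "\<And>a. a \<in> V \<Longrightarrow> \<exists>z\<in>Y. d a z < inverse (Suc n)"
      by (rule maximal_separated_subset[of V "inverse (Suc n)"]) (use VM in auto)
    have Ycl: "closedin mtopology Y" using Y VM by (simp add: closedin_contains_derived_set)
    show ?thesis
    proof (cases "e n \<in> J")
      case True
      then have "good n V Y" using Y Ycl by (auto simp: good_def core_def)
      then show ?thesis ..
    next
      case False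
      obtain G where G: "openin mtopology G" "Y \<subseteq> G" "mtopology closure_of G \<subseteq> V"
        using normal_space_mtopology Ycl V Y(1) unfolding normal_space_alt by meson
      have "Y \<subseteq> core n (mtopology closure_of G)"
        using G(1,2) False closure_of_subset[OF openin_subset[OF G(1)]]
          interior_of_maximal[of G "mtopology closure_of G" mtopology]
        by (simp add: core_def subset_iff)
      then have "good n V (mtopology closure_of G)"
        unfolding good_def using G(3) False Y(3) by (meson closedin_closure_of subsetD)
      then show ?thesis ..
    qed
  qed
  define c where "c n V = (SOME C. good n V C)" for n V
  have good_c: "good n V (c n V)" if "openin mtopology V" for n V
    unfolding c_def by (rule someI_ex[OF good_ex[OF that]])
  define U where "U = rec_nat T (\<lambda>n V. V - c n V)"
  define C where "C n = c n (U n)" for n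
  define A where "A n = core n (C n)" for n
  have U0: "U 0 = T" and US: "U (Suc n) = U n - C n" for n by (simp_all add: U_def C_def)
  have good: "openin mtopology (U n) \<and> good n (U n) (C n)" for n
  proof (induction n)
    case 0
    show ?case using good_c[OF T] by (simp add: U0 C_def T)
  next
    case (Suc n)
    then have "openin mtopology (U (Suc n))" by (auto simp: US good_def)
    then show ?case using good_c by (simp add: C_def)
  qed
  then have Uop: "openin mtopology (U n)" and Ccl: "closedin mtopology (C n)" and CU: "C n \<subseteq> U n"
    and Cd: "e n \<in> J \<Longrightarrow> mtopology derived_set_of (C n) = {}"
    and An: "x \<in> U n \<Longrightarrow> \<exists>y\<in>A n. d x y < inverse (Suc n)" for n x
    unfolding good_def A_def by blast+
  have AC: "A n \<subseteq> C n" for n using core_sub by (simp add: A_def)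
  have Udec: "U n \<subseteq> U m" if "m \<le> n" for m n
    using that by (rule lift_Suc_antimono_le[rotated]) (auto simp: US)
  have disj: "m = n" if "x \<in> A m" "x \<in> A n" for m n x
  proof (rule ccontr)
    have *: False if "x \<in> A m" "x \<in> A n" "m < n" for m n
    proof -
      have "U n \<subseteq> U (Suc m)" using that(3) Udec[of "Suc m" n] by simp
      then have "x \<in> U (Suc m)" using that(2) AC[of n] CU[of n] by blast
      then show False using that(1) AC[of m] US[of m] by blast
    qed
    assume "m \<noteq> n" then show False using * that by (metis linorder_neqE_nat)
  qed
  define \<kappa> where "\<kappa> x = (if \<exists>n. x \<in> A n then e (SOME n. x \<in> A n) else j)" for x
  have kA: "\<kappa> x = e n" if "x \<in> A n" for x n
  proof -
    have "x \<in> A (SOME n. x \<in> A n)" using that by (rule someI)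
    then have "(SOME n. x \<in> A n) = n" using that disj by blast
    then show ?thesis using that by (auto simp: \<kappa>_def)
  qed
  have kI: "\<exists>n. x \<in> A n \<and> e n = \<kappa> x" if "\<kappa> x \<in> I" for x
  proof -
    have "\<kappa> x \<noteq> j" using that j IJ by blast
    then obtain n where "x \<in> A n" by (auto simp: \<kappa>_def split: if_splits)
    then show ?thesis using kA by auto
  qed
  have AT: "A n \<subseteq> T" for n using AC[of n] CU[of n] Udec[of 0 n] U0 by simp
  show ?thesis
  proof
    show "\<kappa> \<in> T \<rightarrow> I \<union> J" using e(1) j by (simp add: \<kappa>_def image_subset_iff)
    fix i assume i: "i \<in> I"
    have "fibre T \<kappa> i = (\<Union>n\<in>{n. e n = i}. A n)"
    proof
      show "fibre T \<kappa> i \<subseteq> (\<Union>n\<in>{n. e n = i}. A n)"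
        using kI i unfolding fibre_def by blast
      show "(\<Union>n\<in>{n. e n = i}. A n) \<subseteq> fibre T \<kappa> i"
        using kA AT unfolding fibre_def by blast
    qed
    moreover have "openin mtopology (A n)" if "e n = i" for n
    proof -
      have "e n \<notin> J" using that i IJ by blast
      then show ?thesis by (simp add: A_def core_def)
    qed
    ultimately show "openin mtopology (fibre T \<kappa> i)" by auto
  next
    fix x k assume x: "x \<in> mtopology closure_of T" "x \<in> T \<Longrightarrow> \<kappa> x \<in> J" and k: "k \<in> I \<union> J"
    have xU: "x \<in> mtopology closure_of (U n)" for n
    proof (induction n)
      case 0
      then show ?case using x by (simp add: U0)
    next
      case (Suc n)
      have "x \<notin> mtopology interior_of (C n)"
      proof (cases "e n \<in> J")
        case True
        then show ?thesis
          using dense_in_itself_interior_of_discrete[OF dii, of "C n"] Cd by auto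
      next
        case False
        then have "x \<notin> A n" using x(2) kA[of x n] AT[of n] by auto
        then show ?thesis using False by (simp add: A_def core_def)
      qed
      then show ?case
        unfolding US by (rule closure_of_minus_closed_subset[OF Uop Ccl CU Suc])
    qed
    \<comment> \<open>From stage \<open>N\<close> on, the labelled points found near \<open>x\<close> are different from \<open>x\<close>.\<close>
    obtain N where N: "\<And>n. n \<ge> N \<Longrightarrow> x \<notin> A n"
    proof (cases "\<exists>m. x \<in> A m")
      case True
      then obtain m where m: "x \<in> A m" by blast
      have "x \<notin> A n" if "Suc m \<le> n" for n
      proof
        assume "x \<in> A n"
        with m have "m = n" by (rule disj)
        with that show False by simp
      qed
      then show ?thesis by (rule that)
    qed (use that[of 0] in blast)
    have xM: "x \<in> M" using x(1) unfolding metric_closure_of by blast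
    have "\<exists>y\<in>fibre T \<kappa> k. y \<noteq> x \<and> y \<in> mball x r" if r: "r > 0" for r
    proof -
      obtain N' where N': "inverse (real (Suc N')) < r / 2"
        using reals_Archimedean r by (metis half_gt_zero)
      obtain n where n: "n \<ge> max N N'" "e n = k" using rec k by blast
      have "inverse (real (Suc n)) \<le> inverse (real (Suc N'))" using n by (simp add: field_simps)
      then have nr: "inverse (real (Suc n)) < r / 2" using N' by linarith
      obtain u where u: "u \<in> U n" "u \<in> mball x (r/2)"
        using xU[of n] half_gt_zero[OF r] unfolding metric_closure_of by blast
      obtain y where y: "y \<in> A n" "d u y < inverse (Suc n)" using An u by blast
      have yM: "y \<in> M" using y AT[of n] openin_subset[OF T] by auto
      have "d x y \<le> d x u + d u y" using u yM triangle by auto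
      then have "d x y < r" using u y nr by auto
      moreover have "y \<noteq> x" using N[of n] n y by auto
      moreover have "y \<in> fibre T \<kappa> k" using y kA[of y n] AT[of n] n by (auto simp: fibre_def)
      ultimately show ?thesis using xM yM by auto
    qed
    then show "x \<in> mtopology derived_set_of (fibre T \<kappa> k)"
      using xM unfolding metric_derived_set_of by blast
  next
    assume "T \<noteq> {}"
    then obtain y where "y \<in> A 0" using An U0 by blast
    then show "\<exists>x\<in>T. \<kappa> x \<in> J" using kA[of y 0] AT[of 0] e(2) j by (intro bexI[of _ y]) auto
  qed
qed

text \<open>
  The subspace \<open>U\<close> is metrizable, hence normal.
\<close>

lemma (in Metric_space) separation_within_open:
  assumes U: "openin mtopology U" and AB: "U \<inter> mtopology closure_of A \<inter> mtopology closure_of B = {}"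
  obtains V V' where "openin mtopology V" "openin mtopology V'" "V \<subseteq> U" "V' \<subseteq> U"
    "U \<inter> mtopology closure_of A \<subseteq> V" "U \<inter> mtopology closure_of B \<subseteq> V'"
    "U \<inter> mtopology closure_of V \<inter> mtopology closure_of V' = {}"
proof -
  let ?Y = "subtopology mtopology U"
  let ?A = "U \<inter> mtopology closure_of A" and ?B = "U \<inter> mtopology closure_of B"
  have "normal_space ?Y"
    by (simp add: metrizable_imp_normal_space metrizable_space_mtopology metrizable_space_subtopology)
  moreover have "closedin ?Y ?A" "closedin ?Y ?B"
    unfolding closedin_subtopology by (metis closedin_closure_of inf_commute)+
  moreover have "disjnt ?A ?B"
    using AB by (auto simp: disjnt_def)
  ultimately have "\<exists>V V'. openin ?Y V \<and> openin ?Y V' \<and> ?A \<subseteq> V \<and> ?B \<subseteq> V' \<and>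
      disjnt (?Y closure_of V) (?Y closure_of V')"
    unfolding normal_space_disjoint_closures by simp
  then obtain V V' where V: "openin ?Y V" "openin ?Y V'" "?A \<subseteq> V" "?B \<subseteq> V'"
      "disjnt (?Y closure_of V) (?Y closure_of V')"
    by (elim exE conjE)
  have O: "openin mtopology V \<and> V \<subseteq> U" "openin mtopology V' \<and> V' \<subseteq> U"
    using V(1,2) U by (simp_all add: openin_open_subtopology)
  then have "U \<inter> V = V" "U \<inter> V' = V'" by (simp_all add: inf.absorb2)
  then have "U \<inter> mtopology closure_of V \<inter> mtopology closure_of V' = {}"
    using V(5) unfolding closure_of_subtopology disjnt_def by (simp add: ac_simps)
  then show ?thesis using that[of V V'] O V(3,4) by simp
qed

section \<open>Representations on open pieces\<close>

lemma fibre_mono: "\<lbrakk>A \<subseteq> B; \<And>x. x \<in> A \<Longrightarrow> \<rho> x = \<tau> x\<rbrakk> \<Longrightarrow> fibre A \<rho> w \<subseteq> fibre B \<tau> w"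
  by (auto simp: fibre_def)

lemma fibre_empty [simp]: "fibre {} \<rho> w = {}"
  by (simp add: fibre_def)

text \<open>
  Whether a point of the open set \<open>S\<close> is a limit of a fibre depends only on the part of the fibre
  inside \<open>S\<close>, and worlds outside \<open>V\<close> neither occur there nor are seen from \<open>V\<close>. Hence a labelling
  that agrees with a representation on \<open>S\<close> behaves correctly at the points of \<open>S\<close>, whatever it does
  elsewhere and however large the ambient frame is.
\<close>

lemma representation_locally:
  assumes rep: "representation X S V R \<tau>" and R: "R `` V \<subseteq> V"
    and SU: "S \<subseteq> U" and eq: "\<And>x. x \<in> S \<Longrightarrow> \<rho> x = \<tau> x" and x: "x \<in> S"
  shows "x \<in> X derived_set_of (fibre U \<rho> w) \<longleftrightarrow> (\<rho> x, w) \<in> R"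
proof -
  have S: "openin X S" "\<tau> x \<in> V" using rep x by (auto simp: representation_def)
  have SI: "S \<inter> fibre U \<rho> w = fibre S \<tau> w" using SU eq by (auto simp: fibre_def)
  have "x \<in> X derived_set_of (fibre U \<rho> w) \<longleftrightarrow> x \<in> X derived_set_of (fibre S \<tau> w)"
    using openin_Int_derived_set_of_eq[OF S(1), of "fibre U \<rho> w"] x unfolding SI by blast
  also have "\<dots> \<longleftrightarrow> (\<tau> x, w) \<in> R"
  proof (cases "w \<in> V")
    case True
    then show ?thesis using rep x by (simp add: representation_def)
  next
    case False
    then have "fibre S \<tau> w = {}" using rep by (auto simp: representation_def fibre_def)
    moreover have "(\<tau> x, w) \<notin> R" using False R S(2) by blast
    ultimately show ?thesis by simp
  qed
  finally show ?thesis using eq x by simp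
qed

lemma representation_cong:
  assumes "representation X U V R \<tau>" "\<And>x. x \<in> U \<Longrightarrow> \<rho> x = \<tau> x"
  shows "representation X U V R \<rho>"
proof -
  have "fibre U \<rho> w = fibre U \<tau> w" for w using assms(2) by (auto simp: fibre_def)
  then show ?thesis using assms by (auto simp: representation_def)
qed

lemma representation_glue:
  assumes "representation X A V R \<rho>" "representation X B V' R \<rho>" "R `` V \<subseteq> V" "R `` V' \<subseteq> V'"
    and "V \<subseteq> W" "V' \<subseteq> W"
  shows "representation X (A \<union> B) W R \<rho>"
  unfolding representation_def
proof (intro conjI ballI)
  show "openin X (A \<union> B)" using assms(1,2) by (auto simp: representation_def)
  show "\<rho> \<in> A \<union> B \<rightarrow> W" using assms by (auto simp: representation_def)
  fix x w assume "x \<in> A \<union> B"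
  then show "x \<in> X derived_set_of (fibre (A \<union> B) \<rho> w) \<longleftrightarrow> (\<rho> x, w) \<in> R"
    using representation_locally[OF assms(1,3), of "A \<union> B" \<rho> x w]
      representation_locally[OF assms(2,4), of "A \<union> B" \<rho> x w] by blast
qed

lemma representation_restrict:
  assumes rep: "representation X S W R \<sigma>" and "openin X A" "A \<subseteq> S" "\<sigma> \<in> A \<rightarrow> V" "V \<subseteq> W"
  shows "representation X A V R \<sigma>"
  unfolding representation_def
proof (intro conjI ballI)
  fix x w assume x: "x \<in> A" and w: "w \<in> V"
  have "A \<inter> fibre S \<sigma> w = fibre A \<sigma> w" using assms(3) by (auto simp: fibre_def)
  then have "x \<in> X derived_set_of (fibre A \<sigma> w) \<longleftrightarrow> x \<in> X derived_set_of (fibre S \<sigma> w)"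
    using openin_Int_derived_set_of_eq[OF assms(2), of "fibre S \<sigma> w"] x by auto
  then show "x \<in> X derived_set_of (fibre A \<sigma> w) \<longleftrightarrow> (\<sigma> x, w) \<in> R"
    using rep subsetD[OF assms(3) x] subsetD[OF assms(5) w] by (simp add: representation_def)
qed (use assms in auto)

text \<open>
  The case \<open>S = {}\<close> of full representability.
\<close>

lemma fully_representable_over_open:
  assumes "fully_representable X V R" "openin X U"
  obtains \<rho> where "full_representation X U U V R \<rho>"
proof -
  have "regular_open_subset X U {}" using assms(2) by (simp add: regular_open_subset_def)
  moreover have "basic_representation X U {} V R (\<lambda>x. undefined)"
    using assms(2) by (simp add: basic_representation_def representation_def)
  ultimately obtain \<rho> where "full_representation X (U - X closure_of {}) U V R \<rho>"
    using assms unfolding fully_representable_def by meson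
  then show ?thesis using that by simp
qed

text \<open>
  A neighbourhood of \<open>x\<close> that misses \<open>U - cl S\<close> meets \<open>U\<close> in an open subset of \<open>U \<inter> cl S\<close>, hence in a subset
  of \<open>S\<close>.
\<close>

lemma regular_open_boundary:
  assumes "regular_open_subset X U S" "x \<in> U" "x \<notin> S"
  shows "x \<in> X closure_of (U - X closure_of S)"
  unfolding in_closure_of
proof (intro conjI allI impI)
  have U: "openin X U" and S: "S = X interior_of (U \<inter> X closure_of S)"
    using assms(1) by (auto simp: regular_open_subset_def)
  show "x \<in> topspace X" using U assms(2) openin_subset by blast
  fix N assume N: "x \<in> N \<and> openin X N"
  show "\<exists>y. y \<in> U - X closure_of S \<and> y \<in> N"
  proof (rule ccontr)
    assume "\<nexists>y. y \<in> U - X closure_of S \<and> y \<in> N"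
    then have "N \<inter> U \<subseteq> U \<inter> X closure_of S" by blast
    then have "N \<inter> U \<subseteq> X interior_of (U \<inter> X closure_of S)"
      using U N by (intro interior_of_maximal) auto
    then have "N \<inter> U \<subseteq> S" using S by simp
    then show False using N assms(2,3) by blast
  qed
qed

section \<open>Frames with a root\<close>

text \<open>
  The worlds that see all of \<open>W\<close> form the root cluster \<open>J\<close>. The dissection of \<open>T = U - cl S\<close> has an open
  piece for each world \<open>v\<close> outside \<open>J\<close>, on which the cone of \<open>v\<close> is represented, and a piece for each
  world of \<open>J\<close>. The points outside \<open>S\<close> and the open pieces are limits of all the pieces, and
  by the fullness of the representations of the cones also of all the fibres.
\<close>

lemma (in Metric_space) fully_representable_reflexive_root:
  fixes W :: "'w set"
  assumes dii: "dense_in_itself mtopology" and W: "countable W" and R: "R `` W \<subseteq> W"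
    and root: "r \<in> W" "W \<subseteq> R `` {r}"
    and below: "\<And>v. \<lbrakk>v \<in> W; \<not> W \<subseteq> R `` {v}\<rbrakk> \<Longrightarrow>
       R `` insert v (R `` {v}) \<subseteq> insert v (R `` {v}) \<and>
       fully_representable mtopology (insert v (R `` {v})) R"
  shows "fully_representable mtopology W R"
  unfolding fully_representable_def
proof (intro allI impI)
  fix U S :: "'a set" and \<sigma> :: "'a \<Rightarrow> 'w"
  assume U: "openin mtopology U" and reg: "regular_open_subset mtopology U S"
    and bas: "basic_representation mtopology U S W R \<sigma>"
  define T where "T = U - mtopology closure_of S"
  define J where "J = {v \<in> W. W \<subseteq> R `` {v}}"
  define I where "I = W - J"
  have IJ: "countable I" "countable J" "I \<inter> J = {}" "J \<noteq> {}" "I \<union> J = W" "r \<in> J"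
    using W root by (auto simp: I_def J_def)
  have SU: "S \<subseteq> U" and Srep: "representation mtopology S W R \<sigma>" and Sop: "openin mtopology S"
    using bas by (auto simp: basic_representation_def representation_def)
  have Top: "openin mtopology T" unfolding T_def using U by (simp add: openin_diff)
  have ST: "S \<inter> T = {}"
    using closure_of_subset[OF openin_subset[OF Sop]] by (auto simp: T_def)
  obtain \<kappa> where kT: "\<kappa> \<in> T \<rightarrow> W" and kop: "\<And>i. i \<in> I \<Longrightarrow> openin mtopology (fibre T \<kappa> i)"
    and klim: "\<And>x k. \<lbrakk>x \<in> mtopology closure_of T; x \<in> T \<Longrightarrow> \<kappa> x \<in> J; k \<in> W\<rbrakk>
       \<Longrightarrow> x \<in> mtopology derived_set_of (fibre T \<kappa> k)"
    and kne: "T \<noteq> {} \<Longrightarrow> \<exists>x\<in>T. \<kappa> x \<in> J"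
    using dissection[OF dii Top IJ(1-4)] unfolding IJ(5) by metis
  define F where "F v = insert v (R `` {v})" for v
  have F: "R `` F v \<subseteq> F v" "fully_representable mtopology (F v) R" "F v \<subseteq> W" if "v \<in> I" for v
    using that below[of v] R by (auto simp: F_def I_def J_def)
  have "\<exists>\<rho>. full_representation mtopology (fibre T \<kappa> v) (fibre T \<kappa> v) (F v) R \<rho>" if "v \<in> I" for v
    using fully_representable_over_open[OF F(2)[OF that] kop[OF that]] by metis
  then obtain \<tau> where \<tau>: "\<And>v. v \<in> I \<Longrightarrow>
      full_representation mtopology (fibre T \<kappa> v) (fibre T \<kappa> v) (F v) R (\<tau> v)"
    by metis
  define \<rho> where "\<rho> x = (if x \<in> S then \<sigma> x else if x \<in> T then
      (if \<kappa> x \<in> I then \<tau> (\<kappa> x) x else \<kappa> x) else r)" for x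
  have \<tau>rep: "representation mtopology (fibre T \<kappa> v) (F v) R (\<tau> v)" if "v \<in> I" for v
    using \<tau>[OF that] by (simp add: full_representation_def)
  have \<rho>\<tau>: "\<rho> x = \<tau> v x" if "v \<in> I" "x \<in> fibre T \<kappa> v" for x v
    using that ST by (auto simp: \<rho>_def fibre_def)
  have TU: "T \<subseteq> U" by (auto simp: T_def)
  have GU: "fibre T \<kappa> v \<subseteq> U" for v using TU by (auto simp: fibre_def)
  \<comment> \<open>Outside \<open>S\<close> and the open pieces, every world is approached.\<close>
  have lim: "x \<in> mtopology derived_set_of (fibre U \<rho> w)"
    if x: "x \<in> mtopology closure_of T" "x \<in> T \<Longrightarrow> \<kappa> x \<in> J" and w: "w \<in> W" for x w
  proof -
    have xd: "x \<in> mtopology derived_set_of (fibre T \<kappa> w)" using klim[OF x w] .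
    show ?thesis
    proof (cases "w \<in> J")
      case True
      then have "fibre T \<kappa> w \<subseteq> fibre U \<rho> w"
        using ST TU by (auto simp: fibre_def \<rho>_def I_def)
      then show ?thesis using xd derived_set_of_mono by blast
    next
      case False
      then have wI: "w \<in> I" using w by (simp add: I_def)
      have "x \<notin> fibre T \<kappa> w" using x(2) False by (auto simp: fibre_def)
      moreover have "x \<in> mtopology closure_of (fibre T \<kappa> w)"
        by (rule subsetD[OF derived_set_of_subset_closure_of xd])
      moreover have "w \<in> F w" by (simp add: F_def)
      ultimately have "x \<in> mtopology derived_set_of (fibre (fibre T \<kappa> w) (\<tau> w) w)"
        using \<tau>[OF wI] unfolding full_representation_def by blast
      moreover have "fibre (fibre T \<kappa> w) (\<tau> w) w \<subseteq> fibre U \<rho> w"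
        by (rule fibre_mono[OF GU]) (use \<rho>\<tau>[OF wI] in simp)
      ultimately show ?thesis using derived_set_of_mono by blast
    qed
  qed
  have into: "\<rho> x \<in> W" if "x \<in> U" for x
  proof (cases "x \<in> T \<and> x \<notin> S \<and> \<kappa> x \<in> I")
    case True
    then have "x \<in> fibre T \<kappa> (\<kappa> x)" by (simp add: fibre_def)
    then have "\<tau> (\<kappa> x) x \<in> F (\<kappa> x)" using True \<tau>rep[of "\<kappa> x"] by (auto simp: representation_def)
    then show ?thesis using True F(3)[of "\<kappa> x"] by (auto simp: \<rho>_def)
  next
    case False
    then show ?thesis using Srep kT root by (auto simp: \<rho>_def representation_def)
  qed
  have rep: "x \<in> mtopology derived_set_of (fibre U \<rho> w) \<longleftrightarrow> (\<rho> x, w) \<in> R"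
    if x: "x \<in> U" and w: "w \<in> W" for x w
  proof -
    consider "x \<in> S" | "x \<in> T" "\<kappa> x \<in> I" | "x \<notin> S" "x \<in> T \<Longrightarrow> \<kappa> x \<in> J"
      using kT IJ(5) by blast
    then show ?thesis
    proof cases
      case 1
      then show ?thesis by (intro representation_locally[OF Srep R SU]) (simp_all add: \<rho>_def)
    next
      case 2
      then show ?thesis
        by (intro representation_locally[OF \<tau>rep F(1) GU]) (auto simp: \<rho>\<tau> fibre_def)
    next
      case 3
      have "x \<in> mtopology closure_of T"
        unfolding T_def by (rule regular_open_boundary[OF reg x 3(1)])
      then have "x \<in> mtopology derived_set_of (fibre U \<rho> w)" using lim 3(2) w by blast
      moreover have "\<rho> x \<in> J" using 3 IJ by (auto simp: \<rho>_def)
      then have "(\<rho> x, w) \<in> R" using w by (auto simp: J_def)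
      ultimately show ?thesis by simp
    qed
  qed
  have bd: "x \<in> mtopology derived_set_of (fibre U \<rho> w)"
    if "x \<in> mtopology closure_of T - U" "w \<in> W" for x w
    using that TU by (intro lim) auto
  have surj: "\<rho> ` U = W" if ne: "T \<noteq> {}"
  proof
    show "\<rho> ` U \<subseteq> W" using into by blast
    obtain x where x: "x \<in> T" "\<kappa> x \<in> J" using kne ne by blast
    have xc: "x \<in> mtopology closure_of T"
      using x closure_of_subset[OF openin_subset[OF Top]] by blast
    show "W \<subseteq> \<rho> ` U"
    proof
      fix w assume "w \<in> W"
      then have "x \<in> mtopology derived_set_of (fibre U \<rho> w)" using lim xc x by blast
      then have "fibre U \<rho> w \<noteq> {}" by auto
      then show "w \<in> \<rho> ` U" by (auto simp: fibre_def)
    qed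
  qed
  have "full_representation mtopology T U W R \<rho>"
    unfolding full_representation_def representation_def
    using Top TU U into rep bd surj by (simp add: Pi_iff)
  then show "\<exists>\<rho>. full_representation mtopology (U - mtopology closure_of S) U W R \<rho> \<and> (\<forall>x\<in>S. \<rho> x = \<sigma> x)"
    unfolding T_def by (intro exI[of _ \<rho>]) (simp add: \<rho>_def)
qed

text \<open>
  Points labelled \<open>r\<close> must not accumulate inside \<open>U\<close>, but they have to accumulate at every point of
  \<open>cl T - U\<close>; this is what \<open>discrete_set_reaching_boundary\<close> provides. The given \<open>\<sigma>\<close> avoids \<open>r\<close>, since
  basicness makes its values reflexive.
\<close>

lemma (in Metric_space) fully_representable_irreflexive_root:
  fixes V :: "'w set"
  assumes dii: "dense_in_itself mtopology" and V: "V = R `` {r}" and r: "r \<notin> V" and R: "R `` V \<subseteq> V"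
    and full: "fully_representable mtopology V R"
  shows "fully_representable mtopology (insert r V) R"
  unfolding fully_representable_def
proof (intro allI impI)
  fix U S :: "'a set" and \<sigma> :: "'a \<Rightarrow> 'w"
  assume U: "openin mtopology U" and reg: "regular_open_subset mtopology U S"
    and bas: "basic_representation mtopology U S (insert r V) R \<sigma>"
  define T where "T = U - mtopology closure_of S"
  have SU: "S \<subseteq> U" and Srep: "representation mtopology S (insert r V) R \<sigma>" and Sop: "openin mtopology S"
    and clique: "\<And>x w v. \<lbrakk>x \<in> U; w \<in> insert r V; v \<in> insert r V;
      x \<in> mtopology closure_of (fibre S \<sigma> w); x \<in> mtopology closure_of (fibre S \<sigma> v)\<rbrakk> \<Longrightarrow> (w, v) \<in> R"
    using bas by (auto simp: basic_representation_def representation_def)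
  have Top: "openin mtopology T" unfolding T_def using U by (simp add: openin_diff)
  have TU: "T \<subseteq> U" by (auto simp: T_def)
  have ST: "S \<inter> T = {}"
    using closure_of_subset[OF openin_subset[OF Sop]] by (auto simp: T_def)
  obtain Z where Z: "Z \<subseteq> T" "mtopology derived_set_of Z \<inter> U = {}"
    "mtopology closure_of T - U \<subseteq> mtopology derived_set_of Z" "T \<noteq> {} \<Longrightarrow> Z \<noteq> {}"
    using discrete_set_reaching_boundary[OF TU U] by metis
  have Zd: "x \<notin> mtopology derived_set_of Z" if "x \<in> Z" for x using that Z(1,2) TU by blast
  define U' where "U' = U - Z"
  have "U' = U - mtopology closure_of Z"
    using Z(1,2) TU openin_subset[OF U] by (auto simp: U'_def closure_of)
  then have U': "openin mtopology U'" using U by (simp add: openin_diff)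
  have intZ: "mtopology interior_of Z = {}"
    using Zd by (intro dense_in_itself_interior_of_discrete[OF dii]) blast
  have clT: "mtopology closure_of (T - Z) = mtopology closure_of T"
    by (rule closure_of_minus_empty_interior[OF Top intZ])
  have SU': "S \<subseteq> U'" using SU ST Z(1) by (auto simp: U'_def)
  have "\<sigma> \<in> S \<rightarrow> V"
  proof
    fix x assume x: "x \<in> S"
    then have "x \<in> fibre S \<sigma> (\<sigma> x)" by (simp add: fibre_def)
    moreover have "fibre S \<sigma> (\<sigma> x) \<subseteq> topspace mtopology"
      using openin_subset[OF Sop] by (auto simp: fibre_def)
    ultimately have "x \<in> mtopology closure_of (fibre S \<sigma> (\<sigma> x))" using closure_of_subset by blast
    moreover have "\<sigma> x \<in> insert r V" using Srep x by (auto simp: representation_def)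
    ultimately have "(\<sigma> x, \<sigma> x) \<in> R" using clique x SU by blast
    then show "\<sigma> x \<in> V" using \<open>\<sigma> x \<in> insert r V\<close> V r by auto
  qed
  then have "representation mtopology S V R \<sigma>"
    by (intro representation_restrict[OF Srep Sop]) auto
  then have bas': "basic_representation mtopology U' S V R \<sigma>"
    unfolding basic_representation_def using U' SU' clique by (auto simp: U'_def)
  have reg': "regular_open_subset mtopology U' S"
    unfolding regular_open_subset_def
  proof (intro conjI equalityI)
    have Seq: "S = mtopology interior_of (U \<inter> mtopology closure_of S)"
      using reg by (simp add: regular_open_subset_def)
    show "S \<subseteq> mtopology interior_of (U' \<inter> mtopology closure_of S)"
      using SU' closure_of_subset[OF openin_subset[OF Sop]] Sop by (intro interior_of_maximal) auto
    have "mtopology interior_of (U' \<inter> mtopology closure_of S)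
        \<subseteq> mtopology interior_of (U \<inter> mtopology closure_of S)"
      by (rule interior_of_mono) (auto simp: U'_def)
    then show "mtopology interior_of (U' \<inter> mtopology closure_of S) \<subseteq> S" using Seq by simp
  qed (fact U' SU')+
  obtain \<tau> where \<tau>: "full_representation mtopology (U' - mtopology closure_of S) U' V R \<tau>"
      and \<tau>S: "\<And>x. x \<in> S \<Longrightarrow> \<tau> x = \<sigma> x"
    using full U' reg' bas' unfolding fully_representable_def by meson
  have T': "U' - mtopology closure_of S = T - Z" by (auto simp: U'_def T_def)
  have \<tau>rep: "representation mtopology U' V R \<tau>"
    and \<tau>lim: "\<And>x w. \<lbrakk>x \<in> mtopology closure_of T; x \<notin> U'; w \<in> V\<rbrakk> \<Longrightarrow>
        x \<in> mtopology derived_set_of (fibre U' \<tau> w)"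
    and \<tau>surj: "T - Z \<noteq> {} \<Longrightarrow> \<tau> ` U' = V"
    using \<tau> unfolding full_representation_def T' clT by auto
  define \<rho> where "\<rho> x = (if x \<in> Z then r else \<tau> x)" for x
  \<comment> \<open>Fullness over \<open>U - Z\<close> covers the points of \<open>Z\<close>, because \<open>T - Z\<close> has the same closure as \<open>T\<close>.\<close>
  have fr: "fibre U \<rho> r = Z"
    using \<tau>rep r Z(1) TU by (auto simp: fibre_def \<rho>_def representation_def U'_def)
  have \<rho>\<tau>: "\<rho> x = \<tau> x" if "x \<in> U'" for x using that by (auto simp: \<rho>_def U'_def)
  have U'U: "U' \<subseteq> U" by (auto simp: U'_def)
  have fv: "x \<in> mtopology derived_set_of (fibre U \<rho> v)"
    if "x \<in> mtopology closure_of T" "x \<notin> U'" "v \<in> V" for x v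
  proof -
    have "fibre U' \<tau> v \<subseteq> fibre U \<rho> v" by (rule fibre_mono[OF U'U]) (simp add: \<rho>\<tau>)
    then show ?thesis using \<tau>lim[OF that] derived_set_of_mono by blast
  qed
  have rep: "x \<in> mtopology derived_set_of (fibre U \<rho> w) \<longleftrightarrow> (\<rho> x, w) \<in> R"
    if x: "x \<in> U" and w: "w \<in> insert r V" for x w
  proof (cases "x \<in> Z")
    case False
    then show ?thesis
      using x by (intro representation_locally[OF \<tau>rep R U'U]) (auto simp: \<rho>\<tau> U'_def)
  next
    case True
    then have xc: "x \<in> mtopology closure_of T" "x \<notin> U'"
      using Z(1) closure_of_subset[OF openin_subset[OF Top]] by (auto simp: U'_def)
    show ?thesis
    proof (cases "w = r")
      case True
      then show ?thesis using Zd[OF \<open>x \<in> Z\<close>] \<open>x \<in> Z\<close> r V by (auto simp: fr \<rho>_def)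
    next
      case False
      then have "w \<in> V" using w by simp
      then show ?thesis using fv[OF xc] \<open>x \<in> Z\<close> V by (auto simp: \<rho>_def)
    qed
  qed
  have into: "\<rho> \<in> U \<rightarrow> insert r V" using \<tau>rep by (auto simp: \<rho>_def representation_def U'_def Pi_iff)
  have bd: "x \<in> mtopology derived_set_of (fibre U \<rho> w)"
    if "x \<in> mtopology closure_of T - U" "w \<in> insert r V" for x w
    using that fv[of x w] Z(3) U'U fr by auto
  have surj: "\<rho> ` U = insert r V" if ne: "T \<noteq> {}"
  proof
    show "\<rho> ` U \<subseteq> insert r V" using into by blast
    have "T - Z \<noteq> {}"
      using clT ne closure_of_subset[OF openin_subset[OF Top]] by (metis closure_of_empty subset_empty)
    then have "V \<subseteq> \<rho> ` U" using \<tau>surj \<rho>\<tau> U'U by (metis image_cong image_mono)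
    moreover obtain z where "z \<in> Z" using Z(4)[OF ne] by blast
    then have "r \<in> \<rho> ` U" using Z(1) TU by (intro image_eqI[of _ _ z]) (auto simp: \<rho>_def)
    ultimately show "insert r V \<subseteq> \<rho> ` U" by blast
  qed
  have "full_representation mtopology T U (insert r V) R \<rho>"
    unfolding full_representation_def representation_def
    using Top TU U into rep bd surj by simp
  moreover have "\<rho> x = \<sigma> x" if "x \<in> S" for x using that \<tau>S \<rho>\<tau> SU' by auto
  ultimately show "\<exists>\<rho>. full_representation mtopology (U - mtopology closure_of S) U (insert r V) R \<rho> \<and> (\<forall>x\<in>S. \<rho> x = \<sigma> x)"
    unfolding T_def by blast
qed


section \<open>Frames without a root\<close>

text \<open>
  Here \<open>V\<close> and \<open>V'\<close> are neighbourhoods of the two parts of \<open>S\<close>, and the interface \<open>Q\<close> is the rest of \<open>U\<close>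
  after the closures of both are removed. A complement of the closure of an open set is regular open,
  and \<open>Q\<close> is separated from the part of \<open>S\<close> in \<open>V\<close>, so their union is again regular open.
\<close>

lemma interface_regular_open:
  assumes reg: "regular_open_subset X U S"
    and V: "openin X V" "openin X V'" "V \<subseteq> U" "V' \<subseteq> U"
      "U \<inter> X closure_of V \<inter> X closure_of V' = {}"
    and SV: "U \<inter> X closure_of S \<subseteq> V \<union> V'"
  defines "Q \<equiv> U - X closure_of V - X closure_of V'"
  shows "regular_open_subset X (U - X closure_of V') (S \<inter> V \<union> Q)"
proof -
  have U: "openin X U" and SU: "S \<subseteq> U" and S: "S = X interior_of (U \<inter> X closure_of S)"
    using reg by (auto simp: regular_open_subset_def)
  have Sop: "openin X S" using S openin_interior_of[of X "U \<inter> X closure_of S"] by simp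
  let ?U = "U - X closure_of V'"
  have U': "openin X ?U" using U by (simp add: openin_diff)
  have Q: "openin X Q" unfolding Q_def using U by (simp add: openin_diff)
  have V1: "V \<subseteq> X closure_of V" "V' \<subseteq> X closure_of V'"
    using V closure_of_subset[OF openin_subset] by blast+
  have VQ: "V \<inter> X closure_of Q = {}"
    using V1 openin_Int_closure_of_eq_empty[OF V(1), of Q] by (auto simp: Q_def)
  have sub: "S \<inter> V \<union> Q \<subseteq> ?U" using V V1 by (auto simp: Q_def)
  have op: "openin X (S \<inter> V \<union> Q)" using Sop V(1) Q by blast
  define N where "N = X interior_of (?U \<inter> X closure_of (S \<inter> V \<union> Q))"
  have Nop: "openin X N" and Nsub: "N \<subseteq> ?U" "N \<subseteq> X closure_of (S \<inter> V) \<union> X closure_of Q"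
    using interior_of_subset[of X "?U \<inter> X closure_of (S \<inter> V \<union> Q)"] by (auto simp: N_def)
  have "N \<subseteq> S \<inter> V \<union> Q"
  proof
    fix x assume x: "x \<in> N"
    show "x \<in> S \<inter> V \<union> Q"
    proof (cases "x \<in> V")
      case True
      have "N \<inter> V \<subseteq> X closure_of (S \<inter> V)" using Nsub(2) VQ by blast
      also have "\<dots> \<subseteq> X closure_of S" by (rule closure_of_mono) blast
      finally have "N \<inter> V \<subseteq> U \<inter> X closure_of S" using V(3) by blast
      then have "N \<inter> V \<subseteq> X interior_of (U \<inter> X closure_of S)"
        using Nop V(1) by (intro interior_of_maximal) auto
      then have "x \<in> S" using x True S by blast
      then show ?thesis using True by blast
    next
      case False
      have "x \<notin> X closure_of V"
      proof
        assume xV: "x \<in> X closure_of V"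
        \<comment> \<open>Near such a point there would be no points of \<open>S \<inter> V\<close>, so \<open>Q\<close> would be dense in an open set meeting \<open>V\<close>.\<close>
        have xU: "x \<in> U" using x Nsub(1) by blast
        have "X closure_of (S \<inter> V) \<subseteq> X closure_of S" by (rule closure_of_mono) blast
        then have "x \<notin> X closure_of (S \<inter> V)" using xU SV False V1(2) Nsub(1) x by blast
        define N' where "N' = N - X closure_of (S \<inter> V)"
        have "openin X N'" unfolding N'_def using Nop by (simp add: openin_diff)
        moreover have "x \<in> N'" using x \<open>x \<notin> X closure_of (S \<inter> V)\<close> by (simp add: N'_def)
        ultimately obtain y where "y \<in> V" "y \<in> N'" using xV unfolding in_closure_of by blast
        then show False using Nsub(2) VQ unfolding N'_def by blast
      qed
      then show ?thesis using x Nsub(1) by (auto simp: Q_def)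
    qed
  qed
  moreover have "S \<inter> V \<union> Q \<subseteq> N"
    unfolding N_def using op sub closure_of_subset[OF openin_subset[OF op]]
    by (intro interior_of_maximal) auto
  ultimately show ?thesis using U' sub by (auto simp: regular_open_subset_def N_def)
qed

text \<open>
  One of the two sides on which a frame without a root is represented. The side is \<open>U - cl V'\<close>, and it
  carries an upward closed part \<open>W1\<close> of the frame, extending \<open>\<sigma>\<close> on \<open>S \<inter> V\<close> and the representation \<open>\<mu>\<close> of
  the cluster \<open>K\<close> on the interface. The prescribed labelling is basic because the closures of \<open>S \<inter> V\<close>
  and of the interface do not meet in the side, and any two worlds of \<open>K\<close> see each other. The set \<open>Z\<close> is a witness
  that what remains of this side reaches the set \<open>E\<close>, which is to be the boundary of
  \<open>U - cl S\<close> outside \<open>U\<close>.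
\<close>

lemma representation_over_side:
  assumes reg: "regular_open_subset X U S" and bas: "basic_representation X U S W R \<sigma>"
    and V: "openin X V" "openin X V'" "V \<subseteq> U" "V' \<subseteq> U"
      "U \<inter> X closure_of V \<inter> X closure_of V' = {}"
    and SV: "U \<inter> X closure_of S \<subseteq> V \<union> V'"
    and W1: "W1 \<subseteq> W" "R `` W1 \<subseteq> W1" "\<sigma> ` (S \<inter> V) \<subseteq> W1" and full: "fully_representable X W1 R"
    and K: "K \<subseteq> W1" "R `` K \<subseteq> K" "\<And>w v. \<lbrakk>w \<in> K; v \<in> K\<rbrakk> \<Longrightarrow> (w, v) \<in> R"
    and \<mu>: "representation X (U - X closure_of V - X closure_of V') K R \<mu>"
    and Z: "Z \<subseteq> V - X closure_of S" "E \<subseteq> X derived_set_of Z" "E \<inter> U = {}"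
  obtains \<rho> where "representation X (U - X closure_of V') W1 R \<rho>"
    "\<And>x. x \<in> S \<inter> V \<Longrightarrow> \<rho> x = \<sigma> x"
    "\<And>x. x \<in> U - X closure_of V - X closure_of V' \<Longrightarrow> \<rho> x = \<mu> x"
    "\<And>x w. \<lbrakk>x \<in> E; w \<in> W1\<rbrakk> \<Longrightarrow> x \<in> X derived_set_of (fibre (U - X closure_of V') \<rho> w)"
    "Z \<noteq> {} \<Longrightarrow> \<rho> ` (U - X closure_of V') = W1"
proof -
  define Q where "Q = U - X closure_of V - X closure_of V'"
  define U1 where "U1 = U - X closure_of V'"
  define A where "A = S \<inter> V"
  have reg1: "regular_open_subset X U1 (A \<union> Q)"
    unfolding U1_def A_def Q_def by (rule interface_regular_open[OF reg V SV])
  have U1: "openin X U1" and sub: "A \<union> Q \<subseteq> U1" using reg1 by (auto simp: regular_open_subset_def)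
  have Srep: "representation X S W R \<sigma>" and Sop: "openin X S"
    and clique: "\<And>x w v. \<lbrakk>x \<in> U; w \<in> W; v \<in> W;
      x \<in> X closure_of (fibre S \<sigma> w); x \<in> X closure_of (fibre S \<sigma> v)\<rbrakk> \<Longrightarrow> (w, v) \<in> R"
    using bas by (auto simp: basic_representation_def representation_def)
  have V1: "V \<subseteq> X closure_of V" using V closure_of_subset[OF openin_subset] by blast
  have AQ: "A \<inter> Q = {}" using V1 by (auto simp: A_def Q_def)
  define \<tau> where "\<tau> x = (if x \<in> Q then \<mu> x else \<sigma> x)" for x
  have Arep: "representation X A W1 R \<sigma>"
    by (rule representation_restrict[OF Srep])
      (use Sop V(1) W1 in \<open>auto simp: A_def\<close>)
  have Arep': "representation X A W1 R \<tau>"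
    by (rule representation_cong[OF Arep]) (use AQ in \<open>auto simp: \<tau>_def\<close>)
  have Qrep: "representation X Q K R \<tau>"
    by (rule representation_cong[OF \<mu>[folded Q_def]]) (auto simp: \<tau>_def)
  have \<tau>rep: "representation X (A \<union> Q) W1 R \<tau>"
    by (rule representation_glue[OF Arep' Qrep W1(2) K(2) _ K(1)]) simp
  have VQ: "V \<inter> X closure_of Q = {}"
    using V1 openin_Int_closure_of_eq_empty[OF V(1), of Q] by (auto simp: Q_def)
  have bas1: "basic_representation X U1 (A \<union> Q) W1 R \<tau>"
    unfolding basic_representation_def
  proof (intro conjI ballI impI)
    fix x w v assume x: "x \<in> U1" and w: "w \<in> W1" and v: "v \<in> W1"
      and xc: "x \<in> X closure_of fibre (A \<union> Q) \<tau> w \<inter> X closure_of fibre (A \<union> Q) \<tau> v"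
    have split: "fibre (A \<union> Q) \<tau> u = fibre A \<sigma> u \<union> fibre Q \<mu> u" for u
      using AQ by (auto simp: fibre_def \<tau>_def)
    have clA: "X closure_of (fibre A \<sigma> u) \<subseteq> X closure_of (fibre S \<sigma> u)" for u
      by (rule closure_of_mono) (auto simp: fibre_def A_def)
    have clAS: "X closure_of (fibre A \<sigma> u) \<subseteq> X closure_of S" for u
      by (rule closure_of_mono) (auto simp: fibre_def A_def)
    have clQ: "X closure_of (fibre Q \<mu> u) \<subseteq> X closure_of Q" for u
      by (rule closure_of_mono) (auto simp: fibre_def)
    have xU: "x \<in> U" "x \<notin> V'"
      using x V closure_of_subset[OF openin_subset[OF V(2)]] by (auto simp: U1_def)
    show "(w, v) \<in> R"
    proof (cases "x \<in> V")
      case True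
      then have "x \<notin> X closure_of Q" using VQ by blast
      then have "x \<in> X closure_of (fibre S \<sigma> w)" "x \<in> X closure_of (fibre S \<sigma> v)"
        using xc clA clQ unfolding split closure_of_Un by blast+
      then show ?thesis using clique xU w v W1(1) by blast
    next
      case False
      then have "x \<notin> X closure_of S" using xU SV by blast
      then have "x \<in> X closure_of (fibre Q \<mu> w)" "x \<in> X closure_of (fibre Q \<mu> v)"
        using xc clAS unfolding split closure_of_Un by blast+
      then have "fibre Q \<mu> w \<noteq> {}" "fibre Q \<mu> v \<noteq> {}" by auto
      then have "w \<in> K" "v \<in> K" using \<mu> by (auto simp: fibre_def representation_def Q_def)
      then show ?thesis by (rule K(3))
    qed
  qed (fact U1 sub \<tau>rep)+
  obtain \<rho> where \<rho>: "full_representation X (U1 - X closure_of (A \<union> Q)) U1 W1 R \<rho>"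
      and \<rho>\<tau>: "\<And>x. x \<in> A \<union> Q \<Longrightarrow> \<rho> x = \<tau> x"
    using full U1 reg1 bas1 unfolding fully_representable_def by meson
  have clA: "X closure_of A \<subseteq> X closure_of S" by (rule closure_of_mono) (auto simp: A_def)
  have ZT: "Z \<subseteq> U1 - X closure_of (A \<union> Q)"
    using Z(1) V(3,5) V1 VQ clA by (auto simp: U1_def)
  have El: "x \<in> X derived_set_of (fibre U1 \<rho> w)" if "x \<in> E" "w \<in> W1" for x w
  proof -
    have "x \<in> X derived_set_of Z" using that Z(2) by blast
    then have "x \<in> X closure_of (U1 - X closure_of (A \<union> Q))"
      using derived_set_of_subset_closure_of[of X Z] closure_of_mono[OF ZT, of X] by blast
    moreover have "x \<notin> U1" using that Z(3) by (auto simp: U1_def)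
    ultimately show ?thesis using \<rho> that unfolding full_representation_def by blast
  qed
  show ?thesis
  proof
    show "representation X (U - X closure_of V') W1 R \<rho>"
      using \<rho> by (simp add: full_representation_def U1_def)
    show "\<rho> x = \<sigma> x" if "x \<in> S \<inter> V" for x
      using that \<rho>\<tau>[of x] AQ by (auto simp: A_def \<tau>_def)
    show "\<rho> x = \<mu> x" if "x \<in> U - X closure_of V - X closure_of V'" for x
      using that \<rho>\<tau>[of x] by (auto simp: Q_def \<tau>_def)
    show "x \<in> X derived_set_of (fibre (U - X closure_of V') \<rho> w)" if "x \<in> E" "w \<in> W1" for x w
      using El[OF that] by (simp add: U1_def)
    show "\<rho> ` (U - X closure_of V') = W1" if "Z \<noteq> {}"
      using \<rho> that ZT unfolding full_representation_def U1_def by blast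
  qed
qed

text \<open>
  Both sides have to be surjective and full on their own, so each of them must contain a set that
  accumulates at all of \<open>E\<close>. The disjoint discrete sets \<open>Y\<close> and \<open>Z\<close> are therefore separated together with
  the parts \<open>A\<close> and \<open>B\<close> of \<open>S\<close>.
\<close>

lemma (in Metric_space) fully_representable_union:
  fixes W1 W2 :: "'w set"
  assumes dii: "dense_in_itself mtopology" and fin: "finite W1" "finite W2"
    and up: "R `` W1 \<subseteq> W1" "R `` W2 \<subseteq> W2"
    and full: "fully_representable mtopology W1 R" "fully_representable mtopology W2 R"
    and K: "K \<subseteq> W1 \<inter> W2" "R `` K \<subseteq> K" "\<And>w v. \<lbrakk>w \<in> K; v \<in> K\<rbrakk> \<Longrightarrow> (w, v) \<in> R"
      "fully_representable mtopology K R"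
  shows "fully_representable mtopology (W1 \<union> W2) R"
  unfolding fully_representable_def
proof (intro allI impI)
  fix U S :: "'a set" and \<sigma> :: "'a \<Rightarrow> 'w"
  assume U: "openin mtopology U" and reg: "regular_open_subset mtopology U S"
    and bas: "basic_representation mtopology U S (W1 \<union> W2) R \<sigma>"
  define T where "T = U - mtopology closure_of S"
  define E where "E = mtopology closure_of T - U"
  have SU: "S \<subseteq> U" and \<sigma>W: "\<sigma> \<in> S \<rightarrow> W1 \<union> W2" and Sop: "openin mtopology S"
    and clique: "\<And>x w v. \<lbrakk>x \<in> U; w \<in> W1 \<union> W2; v \<in> W1 \<union> W2;
      x \<in> mtopology closure_of (fibre S \<sigma> w); x \<in> mtopology closure_of (fibre S \<sigma> v)\<rbrakk> \<Longrightarrow> (w, v) \<in> R"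
    using bas by (auto simp: basic_representation_def representation_def)
  have Top: "openin mtopology T" unfolding T_def using U by (simp add: openin_diff)
  have TU: "T \<subseteq> U" by (auto simp: T_def)
  obtain Y Z where YZ: "Y \<subseteq> T" "Z \<subseteq> T" "Y \<inter> Z = {}"
    "mtopology derived_set_of Y \<inter> U = {}" "mtopology derived_set_of Z \<inter> U = {}"
    "E \<subseteq> mtopology derived_set_of Y" "E \<subseteq> mtopology derived_set_of Z"
    "T \<noteq> {} \<Longrightarrow> Y \<noteq> {}" "T \<noteq> {} \<Longrightarrow> Z \<noteq> {}"
    using two_discrete_sets_reaching_boundary[OF dii TU Top U] unfolding E_def by metis
  define A where "A = {x \<in> S. \<sigma> x \<in> W1}"
  define B where "B = {x \<in> S. \<sigma> x \<notin> W1}"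
  have AB: "A \<union> B = S" by (auto simp: A_def B_def)
  have A: "A = (\<Union>w\<in>W1. fibre S \<sigma> w)" by (auto simp: A_def fibre_def)
  have B: "B = (\<Union>w\<in>W2 - W1. fibre S \<sigma> w)" using \<sigma>W by (auto simp: B_def fibre_def)
  have clA: "mtopology closure_of A = (\<Union>w\<in>W1. mtopology closure_of (fibre S \<sigma> w))"
    unfolding A using fin by (simp add: closure_of_Union)
  have clB: "mtopology closure_of B = (\<Union>w\<in>W2 - W1. mtopology closure_of (fibre S \<sigma> w))"
    unfolding B using fin by (simp add: closure_of_Union)
  have clAB: "U \<inter> mtopology closure_of A \<inter> mtopology closure_of B = {}"
  proof (rule ccontr)
    assume "\<not> ?thesis"
    then obtain x w v where "x \<in> U" "w \<in> W1" "v \<in> W2 - W1"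
        "x \<in> mtopology closure_of (fibre S \<sigma> w)" "x \<in> mtopology closure_of (fibre S \<sigma> v)"
      unfolding clA clB by blast
    then have "(w, v) \<in> R" using clique by blast
    then show False using up(1) \<open>w \<in> W1\<close> \<open>v \<in> W2 - W1\<close> by blast
  qed
  have clS: "mtopology closure_of S = mtopology closure_of A \<union> mtopology closure_of B"
    by (simp flip: AB)
  have clY: "U \<inter> mtopology closure_of Y = Y" "U \<inter> mtopology closure_of Z = Z"
    using YZ TU openin_subset[OF U] by (auto simp: closure_of)
  have "U \<inter> mtopology closure_of (A \<union> Y) \<inter> mtopology closure_of (B \<union> Z) = {}"
    using clAB clY clS YZ(1,2,3) unfolding T_def closure_of_Un by blast
  then obtain V V' where V: "openin mtopology V" "openin mtopology V'" "V \<subseteq> U" "V' \<subseteq> U"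
      "U \<inter> mtopology closure_of V \<inter> mtopology closure_of V' = {}"
    and AV: "U \<inter> mtopology closure_of (A \<union> Y) \<subseteq> V" and BV: "U \<inter> mtopology closure_of (B \<union> Z) \<subseteq> V'"
    by (rule separation_within_open[OF U]) blast
  have V'': "U \<inter> mtopology closure_of V' \<inter> mtopology closure_of V = {}" using V(5) by blast
  have SV: "U \<inter> mtopology closure_of S \<subseteq> V \<union> V'" using AV BV unfolding clS closure_of_Un by blast
  have SV': "U \<inter> mtopology closure_of S \<subseteq> V' \<union> V" using SV by blast
  have V1: "V \<subseteq> mtopology closure_of V" "V' \<subseteq> mtopology closure_of V'"
    using V closure_of_subset[OF openin_subset] by blast+
  have VV: "V \<inter> V' = {}" using V V1 by blast
  have sub: "A \<subseteq> V" "B \<subseteq> V'"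
    using closure_of_subset[OF openin_subset[OF Sop]] AV BV SU AB
      closure_of_subset[of A mtopology] closure_of_subset[of B mtopology] openin_subset[OF Sop]
    unfolding closure_of_Un by blast+
  have side: "\<sigma> ` (S \<inter> V) \<subseteq> W1" "\<sigma> ` (S \<inter> V') \<subseteq> W2"
    using sub VV AB \<sigma>W by (auto simp: A_def B_def)
  have YV: "Y \<subseteq> V - mtopology closure_of S" "Z \<subseteq> V' - mtopology closure_of S"
    using clY AV BV YZ(1,2) unfolding closure_of_Un T_def by blast+
  have EU: "E \<inter> U = {}" by (auto simp: E_def)
  define Q where "Q = U - mtopology closure_of V - mtopology closure_of V'"
  have Q': "U - mtopology closure_of V' - mtopology closure_of V = Q" by (auto simp: Q_def)
  have Qop: "openin mtopology Q" unfolding Q_def using U by (simp add: openin_diff)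
  obtain \<mu> where "full_representation mtopology Q Q K R \<mu>"
    using fully_representable_over_open[OF K(4) Qop] by metis
  then have \<mu>: "representation mtopology Q K R \<mu>" by (simp add: full_representation_def)
  define U1 where "U1 = U - mtopology closure_of V'"
  define U2 where "U2 = U - mtopology closure_of V"
  have K12: "K \<subseteq> W1" "K \<subseteq> W2" using K(1) by auto
  obtain \<rho>1 where \<rho>1: "representation mtopology U1 W1 R \<rho>1"
    "\<And>x. x \<in> S \<inter> V \<Longrightarrow> \<rho>1 x = \<sigma> x" "\<And>x. x \<in> Q \<Longrightarrow> \<rho>1 x = \<mu> x"
    "\<And>x w. \<lbrakk>x \<in> E; w \<in> W1\<rbrakk> \<Longrightarrow> x \<in> mtopology derived_set_of (fibre U1 \<rho>1 w)"
    "Y \<noteq> {} \<Longrightarrow> \<rho>1 ` U1 = W1"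
    using representation_over_side[OF reg bas V SV _ up(1) side(1) full(1) K12(1) K(2,3) \<mu>[unfolded Q_def]
        YV(1) YZ(6) EU, folded Q_def U1_def] by (metis Un_upper1)
  obtain \<rho>2 where \<rho>2: "representation mtopology U2 W2 R \<rho>2"
    "\<And>x. x \<in> S \<inter> V' \<Longrightarrow> \<rho>2 x = \<sigma> x" "\<And>x. x \<in> Q \<Longrightarrow> \<rho>2 x = \<mu> x"
    "\<And>x w. \<lbrakk>x \<in> E; w \<in> W2\<rbrakk> \<Longrightarrow> x \<in> mtopology derived_set_of (fibre U2 \<rho>2 w)"
    "Z \<noteq> {} \<Longrightarrow> \<rho>2 ` U2 = W2"
    using representation_over_side[OF reg bas V(2,1,4,3) V'' SV' _ up(2) side(2) full(2) K12(2) K(2,3)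
        \<mu>[folded Q'] YV(2) YZ(7) EU, unfolded Q', folded U2_def] by (metis Un_upper2)
  define \<rho> where "\<rho> x = (if x \<in> U1 then \<rho>1 x else \<rho>2 x)" for x
  have U12: "U1 \<union> U2 = U" "U1 \<inter> U2 = Q" using V(5) by (auto simp: U1_def U2_def Q_def)
  have e1: "\<rho> x = \<rho>1 x" if "x \<in> U1" for x using that by (simp add: \<rho>_def)
  have e2: "\<rho> x = \<rho>2 x" if "x \<in> U2" for x
    using that \<rho>1(3) \<rho>2(3) U12(2) by (auto simp: \<rho>_def)
  have rep: "representation mtopology U (W1 \<union> W2) R \<rho>"
    unfolding U12(1)[symmetric]
    by (rule representation_glue[OF representation_cong[OF \<rho>1(1) e1] representation_cong[OF \<rho>2(1) e2] up])
      auto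
  have bd: "x \<in> mtopology derived_set_of (fibre U \<rho> w)" if x: "x \<in> E" and w: "w \<in> W1 \<union> W2" for x w
  proof -
    have "fibre U1 \<rho>1 w \<subseteq> fibre U \<rho> w" "fibre U2 \<rho>2 w \<subseteq> fibre U \<rho> w"
      by (rule fibre_mono; use U12(1) e1 e2 in auto)+
    then show ?thesis
      using w \<rho>1(4)[OF x] \<rho>2(4)[OF x] derived_set_of_mono by blast
  qed
  have surj: "\<rho> ` U = W1 \<union> W2" if "T \<noteq> {}"
  proof -
    have "\<rho> ` U1 = W1" "\<rho> ` U2 = W2"
      using \<rho>1(5) \<rho>2(5) YZ(8,9) that e1 e2 by (metis image_cong)+
    then show ?thesis using U12(1) by (metis image_Un)
  qed
  have "full_representation mtopology T U (W1 \<union> W2) R \<rho>"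
    unfolding full_representation_def using Top TU rep bd surj by (simp add: E_def)
  moreover have "\<rho> x = \<sigma> x" if "x \<in> S" for x
  proof (cases "x \<in> A")
    case True
    then have "x \<in> V" using sub by blast
    then have "x \<in> U1" using V V1 by (auto simp: U1_def)
    then show ?thesis using e1 \<rho>1(2) that \<open>x \<in> V\<close> by simp
  next
    case False
    then have "x \<in> V'" using sub that AB by blast
    then have "x \<in> U2" using V V1 by (auto simp: U2_def)
    then show ?thesis using e2 \<rho>2(2) that \<open>x \<in> V'\<close> by simp
  qed
  ultimately show "\<exists>\<rho>. full_representation mtopology (U - mtopology closure_of S) U (W1 \<union> W2) R \<rho> \<and> (\<forall>x\<in>S. \<rho> x = \<sigma> x)"
    unfolding T_def by blast
qed


section \<open>Decomposition of connected frames\<close>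

lemma rtrancl_crossing_edge:
  assumes "(a, b) \<in> E\<^sup>*" "a \<in> V" "b \<notin> V"
  obtains x y where "(x, y) \<in> E" "x \<in> V" "y \<notin> V"
  using assms by (induction rule: rtrancl_induct) blast+

lemma connected_frame_Un:
  assumes A: "connected_frame A (R \<inter> A \<times> A)" and B: "connected_frame B (R \<inter> B \<times> B)"
    and m: "m \<in> A" "m \<in> B"
  shows "connected_frame (A \<union> B) (R \<inter> (A \<union> B) \<times> (A \<union> B))"
proof -
  let ?E = "\<lambda>V. (R \<inter> V \<times> V) \<union> (R \<inter> V \<times> V)\<inverse>"
  have mono: "(?E A)\<^sup>* \<subseteq> (?E (A \<union> B))\<^sup>*" "(?E B)\<^sup>* \<subseteq> (?E (A \<union> B))\<^sup>*"
    by (rule rtrancl_mono; blast)+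
  have "(u, m) \<in> (?E (A \<union> B))\<^sup>* \<and> (m, u) \<in> (?E (A \<union> B))\<^sup>*" if "u \<in> A \<union> B" for u
    using that A B m mono unfolding connected_frame_def by blast
  then show ?thesis unfolding connected_frame_def by (blast intro: rtrancl_trans)
qed

lemma connected_frame_cone:
  "connected_frame (insert v (R `` {v})) (R \<inter> insert v (R `` {v}) \<times> insert v (R `` {v}))"
proof -
  let ?F = "insert v (R `` {v})"
  let ?E = "(R \<inter> ?F \<times> ?F) \<union> (R \<inter> ?F \<times> ?F)\<inverse>"
  have "(u, v) \<in> ?E\<^sup>* \<and> (v, u) \<in> ?E\<^sup>*" if "u \<in> ?F" for u
  proof (cases "u = v")
    case False
    then have "(u, v) \<in> ?E" "(v, u) \<in> ?E" using that by auto
    then show ?thesis by blast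
  qed auto
  then show ?thesis unfolding connected_frame_def by (blast intro: rtrancl_trans)
qed

text \<open>
  A world \<open>m\<close> that sees as few worlds as possible: every world in \<open>R `` {m}\<close> sees the same ones.
\<close>

lemma final_cluster_exists:
  assumes "finite V" "V \<noteq> {}" "trans R" "R `` V \<subseteq> V" and ser: "\<And>w. w \<in> V \<Longrightarrow> R `` {w} \<noteq> {}"
  obtains K where "K \<noteq> {}" "K \<subseteq> V" "R `` K \<subseteq> K" "\<And>w v. \<lbrakk>w \<in> K; v \<in> K\<rbrakk> \<Longrightarrow> (w, v) \<in> R"
proof -
  obtain m where m: "m \<in> V" and min: "\<And>v. v \<in> V \<Longrightarrow> card (R `` {m}) \<le> card (R `` {v})"
    using ex_has_least_nat[of "\<lambda>v. v \<in> V" _ "\<lambda>v. card (R `` {v})"] assms(2) by blast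
  have mV: "R `` {m} \<subseteq> V" using m assms(4) by blast
  have eq: "R `` {v} = R `` {m}" if v: "v \<in> R `` {m}" for v
  proof (rule card_subset_eq)
    show "finite (R `` {m})" using mV assms(1) finite_subset by blast
    show sub: "R `` {v} \<subseteq> R `` {m}" using v assms(3) by (auto dest: transD)
    have "v \<in> V" using v mV by blast
    then have "card (R `` {m}) \<le> card (R `` {v})" by (rule min)
    then show "card (R `` {v}) = card (R `` {m})"
      using card_mono[OF \<open>finite (R `` {m})\<close> sub] by simp
  qed
  show ?thesis
  proof
    show "R `` {m} \<noteq> {}" using ser m .
    show "R `` {m} \<subseteq> V" by fact
    show "R `` (R `` {m}) \<subseteq> R `` {m}" using eq by blast
    show "(w, v) \<in> R" if "w \<in> R `` {m}" "v \<in> R `` {m}" for w v using eq that by blast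
  qed
qed

text \<open>
  Take \<open>A\<close> maximal among the proper upward closed connected subsets. Since \<open>V\<close> is connected, an edge
  joins \<open>A\<close> to its complement, and as \<open>A\<close> is upward closed that edge leads from some \<open>y\<close> outside \<open>A\<close> into
  \<open>A\<close>. The cone of \<open>y\<close> is proper, as \<open>V\<close> has no root, and its union with \<open>A\<close> is connected, so by
  maximality this union is \<open>V\<close>.
\<close>

lemma rootless_connected_decomposition:
  assumes fin: "finite V" and "V \<noteq> {}" and tr: "trans R" and up: "R `` V \<subseteq> V"
    and con: "connected_frame V (R \<inter> V \<times> V)"
    and rootless: "\<And>w. w \<in> V \<Longrightarrow> insert w (R `` {w}) \<noteq> V"
  obtains A B where "A \<union> B = V" "A \<inter> B \<noteq> {}" "A \<noteq> V" "B \<noteq> V" "R `` A \<subseteq> A" "R `` B \<subseteq> B"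
    "connected_frame A (R \<inter> A \<times> A)" "connected_frame B (R \<inter> B \<times> B)"
proof -
  define cone where "cone w = insert w (R `` {w})" for w
  define P where "P A \<longleftrightarrow> A \<subseteq> V \<and> A \<noteq> V \<and> A \<noteq> {} \<and> R `` A \<subseteq> A \<and> connected_frame A (R \<inter> A \<times> A)" for A
  have cone: "cone w \<subseteq> V" "cone w \<noteq> V" "R `` cone w \<subseteq> cone w"
      "connected_frame (cone w) (R \<inter> cone w \<times> cone w)" if "w \<in> V" for w
    using that up rootless[OF that] transD[OF tr] connected_frame_cone[of w R]
    by (auto simp: cone_def)
  obtain w0 where "w0 \<in> V" using assms(2) by blast
  then have P0: "P (cone w0)" using cone[of w0] by (simp add: P_def) (simp add: cone_def)
  have "\<forall>A. P A \<longrightarrow> card A < Suc (card V)"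
    using fin card_mono by (fastforce simp: P_def less_Suc_eq_le)
  then obtain A where PA: "P A" and max: "\<And>B. P B \<Longrightarrow> card B \<le> card A"
    using ex_has_greatest_nat[of P "cone w0" card] P0 by blast
  have A: "A \<subseteq> V" "A \<noteq> V" "A \<noteq> {}" "R `` A \<subseteq> A" "connected_frame A (R \<inter> A \<times> A)"
    using PA by (auto simp: P_def)
  obtain a b where ab: "a \<in> A" "b \<in> V" "b \<notin> A" using A by blast
  then have "(a, b) \<in> ((R \<inter> V \<times> V) \<union> (R \<inter> V \<times> V)\<inverse>)\<^sup>*"
    using con A(1) unfolding connected_frame_def by blast
  then obtain x y where xy: "(x, y) \<in> (R \<inter> V \<times> V) \<union> (R \<inter> V \<times> V)\<inverse>" "x \<in> A" "y \<notin> A"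
    using ab(1,3) by (rule rtrancl_crossing_edge)
  then have y: "(y, x) \<in> R" "y \<in> V" using A(4) by blast+
  have x: "x \<in> A \<inter> cone y" using xy y by (simp add: cone_def)
  have eq: "A \<union> cone y = V"
  proof (rule ccontr)
    assume "A \<union> cone y \<noteq> V"
    then have "P (A \<union> cone y)"
      using A cone[OF y(2)] x connected_frame_Un[OF A(5) cone(4)[OF y(2)], of x]
      unfolding P_def by blast
    then have "card (A \<union> cone y) \<le> card A" by (rule max)
    moreover have "A \<subset> A \<union> cone y" using xy(3) by (auto simp: cone_def)
    then have "card A < card (A \<union> cone y)"
      by (rule psubset_card_mono[rotated]) (use A(1) cone(1)[OF y(2)] fin in \<open>auto intro: finite_subset\<close>)
    ultimately show False by simp
  qed
  show ?thesis
    by (rule that[of A "cone y"]) (use eq x A cone[OF y(2)] in auto)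
qed

section \<open>Full representability\<close>

text \<open>
  The induction needs smaller frames only of the following kinds: cones, successor sets, the two parts
  of a decomposition, and clusters. All of them are upward closed in \<open>V\<close>, so transitivity, seriality and
  local connectedness are inherited from the fixed relation \<open>R\<close> and only connectedness has to
  be proved again.
\<close>

lemma (in Metric_space) fully_representable_upset:
  fixes W :: "'w set"
  assumes dii: "dense_in_itself mtopology" and W: "finite W" "KD4_frame W R" "locally_connected_frame W R"
    and "V \<subseteq> W" "V \<noteq> {}" "R `` V \<subseteq> V" "connected_frame V (R \<inter> V \<times> V)"
  shows "fully_representable mtopology V R"
  using assms(5-)
proof (induction "card V" arbitrary: V rule: less_induct)
  case less
  note V = less.prems
  have tr: "trans R" and ser: "\<And>w. w \<in> W \<Longrightarrow> R `` {w} \<noteq> {}"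
    using W(2) by (auto simp: KD4_frame_def)
  have fin: "finite V" using V(1) W(1) finite_subset by blast
  have IH: "fully_representable mtopology A R"
    if "A \<subseteq> V" "A \<noteq> V" "A \<noteq> {}" "R `` A \<subseteq> A" "connected_frame A (R \<inter> A \<times> A)" for A
    using less.hyps[of A] that V(1) fin by (metis psubsetI psubset_card_mono subset_trans)
  show ?case
  proof (cases "\<exists>r\<in>V. insert r (R `` {r}) = V")
    case True
    then obtain r where r: "r \<in> V" "insert r (R `` {r}) = V" by blast
    show ?thesis
    proof (cases "(r, r) \<in> R")
      case True
      show ?thesis
      proof (rule fully_representable_reflexive_root[OF dii countable_finite[OF fin] V(3) r(1)])
        show "V \<subseteq> R `` {r}" using r True by blast
        fix v assume v: "v \<in> V" "\<not> V \<subseteq> R `` {v}"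
        let ?F = "insert v (R `` {v})"
        have up: "R `` ?F \<subseteq> ?F" using transD[OF tr] by blast
        \<comment> \<open>A world seeing \<open>r\<close> sees everything, so the cone of \<open>v\<close> omits \<open>r\<close>.\<close>
        have "V \<subseteq> R `` {v}" if "r \<in> ?F"
          using that r True transD[OF tr] by blast
        then have "?F \<noteq> V" using v(2) r(1) by blast
        moreover have "?F \<subseteq> V" using v(1) V(3) by blast
        ultimately have "fully_representable mtopology ?F R"
          using IH[of ?F] up connected_frame_cone[of v R] by blast
        with up show "R `` ?F \<subseteq> ?F \<and> fully_representable mtopology ?F R" ..
      qed
    next
      case False
      let ?K = "R `` {r}"
      have "R `` ?K \<subseteq> ?K" using transD[OF tr] by blast
      moreover have "?K \<subseteq> V" "?K \<noteq> V" using r False by blast+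
      moreover have "?K \<noteq> {}" using ser r(1) V(1) by blast
      moreover have "connected_frame ?K (R \<inter> ?K \<times> ?K)"
        using W(3) r(1) V(1) unfolding locally_connected_frame_def by blast
      ultimately have "fully_representable mtopology (insert r ?K) R"
        using False IH[of ?K] by (intro fully_representable_irreflexive_root[OF dii refl]) auto
      then show ?thesis by (simp only: r(2))
    qed
  next
    case False
    obtain A B where AB: "A \<union> B = V" "A \<inter> B \<noteq> {}" "A \<noteq> V" "B \<noteq> V" "R `` A \<subseteq> A" "R `` B \<subseteq> B"
      "connected_frame A (R \<inter> A \<times> A)" "connected_frame B (R \<inter> B \<times> B)"
      using rootless_connected_decomposition[OF fin V(2) tr V(3,4)] False by metis
    have upAB: "R `` (A \<inter> B) \<subseteq> A \<inter> B" using AB(5,6) by blast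
    have serAB: "R `` {w} \<noteq> {}" if "w \<in> A \<inter> B" for w
      using that AB(1) V(1) by (intro ser) blast
    have "finite (A \<inter> B)" using fin AB(1) by (auto intro: finite_subset)
    then obtain K where K: "K \<noteq> {}" "K \<subseteq> A \<inter> B" "R `` K \<subseteq> K" "\<And>w v. \<lbrakk>w \<in> K; v \<in> K\<rbrakk> \<Longrightarrow> (w, v) \<in> R"
      using final_cluster_exists[OF _ AB(2) tr upAB serAB] by metis
    have "connected_frame K (R \<inter> K \<times> K)" unfolding connected_frame_def using K(4) by blast
    then have Kfull: "fully_representable mtopology K R" using K AB by (intro IH) auto
    have "fully_representable mtopology (A \<union> B) R"
    proof (rule fully_representable_union[OF dii _ _ AB(5,6) _ _ K(2,3,4) Kfull])
      show "finite A" "finite B" using fin AB(1) by auto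
      show "fully_representable mtopology A R" "fully_representable mtopology B R"
        using AB by (auto intro!: IH)
    qed
    then show ?thesis by (simp only: AB(1))
  qed
qed

theorem proposition8p10:
  fixes M :: "'a set" and d :: "'a \<Rightarrow> 'a \<Rightarrow> real"
    and W :: "'w set" and R :: "('w \<times> 'w) set"
  assumes "Metric_space M d"
    and "dense_in_itself (Metric_space.mtopology M d)"
    and "finite W"
    and "KD4_frame W R"
    and "connected_frame W R"
    and "locally_connected_frame W R"
  shows "fully_representable (Metric_space.mtopology M d) W R"
proof (rule Metric_space.fully_representable_upset[OF assms(1-4,6)])
  have R: "R \<subseteq> W \<times> W" "W \<noteq> {}" using assms(4) by (auto simp: KD4_frame_def frame_def)
  then have "R \<inter> W \<times> W = R" by blast
  with assms(5) show "connected_frame W (R \<inter> W \<times> W)" by simp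
  show "W \<subseteq> W" "W \<noteq> {}" "R `` W \<subseteq> W" using R by auto
qed

end
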